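(* Let $f,g$ be two densities on $\mathbb{R}^d$. Let $\{k_N\}_{N\ge 1}$ be a sequence of natural numbers such that $k_N=o(N)$. Then, as $N\to\infty$, $$\frac{1}{N k_N}\,T(\mathscr{G}_{k_N}(\mathcal{Z}_N))\ \xrightarrow{\ p\ }\ \delta(f,g,p),$$ where $\delta(f,g,p)=pq\int_{\mathbb{R}^d}\frac{f(x)g(x)}{pf(x)+qg(x)}\,dx$ is the Henze--Penrose dissimilarity, and $\xrightarrow{p}$ denotes convergence in probability.
   Context: Setting (Poissonized two-sample problem). Let $p\in(0,1)$, $q=1-p$. For each $N$ let $N_1+N_2=N$ with $\frac{N_1}{N}-p=o(N^{-1/2})$ and $\frac{N_2}{N}-q=o(N^{-1/2})$. For densities $f,g$ on $\mathbb{R}^d$ put $\phi_N(x)=\frac{N_1}{N}f(x)+\frac{N_2}{N}g(x)$. $\mathcal{Z}_N=\{Z_1,\dots,Z_{L_N}\}$ is the set of points of a Poisson process on $\mathbb{R}^d$ with intensity function $N\phi_N=N_1f+N_2g$ (so $L_N\sim\mathrm{Poisson}(N)$). Given $\mathcal{Z}_N$, the points receive independent labels: $z\in\mathcal{Z}_N$ gets label $c_z=1$ with probability $\frac{N_1f(z)}{N_1f(z)+N_2g(z)}$ and $c_z=2$ with probability $\frac{N_2g(z)}{N_1f(z)+N_2g(z)}$. For a finite set $S\subset\mathbb{R}^d$ and $K\in\mathbb{N}$, $\mathscr{G}_K(S)$ is the directed $K$-nearest-neighbor graph on $S$: for distinct $a,b\in S$ the edge $(a,b)$ is in $E(\mathscr{G}_K(S))$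 iff $b$ is one of the $K$ closest points to $a$ in Euclidean distance among the other points of $S$. The test statistic is $$T(\mathscr{G}_K(\mathcal{Z}_N))=\sum_{x,y\in\mathcal{Z}_N}\mathbf{1}\{c_x=1,\,c_y=2\}\,\mathbf{1}\{(x,y)\in E(\mathscr{G}_K(\mathcal{Z}_N))\}.$$ The integrand defining $\delta$ is taken to be $0$ where $f=g=0$. *)

theory Defs
  imports "HOL-Probability.Probability" "HOL-Library.Landau_Symbols"
begin

definition prob_density :: "('a::euclidean_space \<Rightarrow> real) \<Rightarrow> bool" where
  "prob_density f \<longleftrightarrow>
     f \<in> borel_measurable borel \<and> (\<forall>x. 0 \<le> f x) \<and> (\<integral>\<^sup>+x. ennreal (f x) \<partial>lborel) = 1"

text \<open>
  Poisson process with a (Lebesgue) integrable intensity function \<open>u\<close>, as a random finite set: the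
  number of points in a Borel set \<open>A\<close> is Poisson with mean \<open>\<integral>\<^sub>A u\<close>, and the numbers of points in
  disjoint Borel sets are independent. The Poisson weights are written out because
  \<^const>\<open>poisson_pmf\<close> is only specified for positive rates; for \<open>\<integral>\<^sub>A u = 0\<close> the formula below
  says that there is almost surely no point in \<open>A\<close> (\<open>0 ^ 0 = 1\<close>).
\<close>

definition poisson_process ::
    "'w measure \<Rightarrow> ('w \<Rightarrow> 'a::euclidean_space set) \<Rightarrow> ('a \<Rightarrow> real) \<Rightarrow> bool" where
  "poisson_process M Z u \<longleftrightarrow>
     prob_space M \<and>
     integrable lborel u \<and> (\<forall>x. 0 \<le> u x) \<and>
     (\<forall>\<omega>\<in>space M. finite (Z \<omega>)) \<and>
     (\<forall>A\<in>sets borel. (\<lambda>\<omega>. card (Z \<omega> \<inter> A)) \<in> M \<rightarrow>\<^sub>M count_space UNIV) \<and>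
     (\<forall>A\<in>sets borel. \<forall>n.
        measure M {\<omega>\<in>space M. card (Z \<omega> \<inter> A) = n} =
        (LINT x:A|lborel. u x) ^ n / fact n * exp (- (LINT x:A|lborel. u x))) \<and>
     (\<forall>(I::nat set) A. finite I \<longrightarrow> (\<forall>i\<in>I. A i \<in> sets borel) \<longrightarrow> disjoint_family_on A I \<longrightarrow>
        prob_space.indep_vars M (\<lambda>_. count_space UNIV) (\<lambda>i \<omega>. card (Z \<omega> \<inter> A i)) I)"

text \<open>The sub-\<open>\<sigma>\<close>-algebra generated by the random point set \<open>Z\<close>, i.e. by its counts.\<close>

definition points_algebra :: "'w measure \<Rightarrow> ('w \<Rightarrow> 'a::euclidean_space set) \<Rightarrow> 'w measure" where
  "points_algebra M Z =
     sigma (space M) {{\<omega>\<in>space M. card (Z \<omega> \<inter> A) = n} |A n. A \<in> sets borel}"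

text \<open>
  Given the random finite set \<open>Z\<close>, its points receive independent labels, and \<open>z \<in> Z\<close> gets label
  \<open>j\<close> with probability \<open>\<pi> z j\<close>. To speak about the labels of the random points, these are listed
  as \<open>X\<^sub>0, \<dots>, X\<^sub>n\<^sub>-\<^sub>1\<close> with \<open>n = card Z\<close>, by an enumeration \<open>X\<close> that is a measurable function
  of \<open>Z\<close> alone (for instance the lexicographic one); the condition is that, for every label
  sequence \<open>a\<close>, the conditional probability given \<open>Z\<close> that the points carry the labels
  \<open>a 0, \<dots>, a (n - 1)\<close> is the product of the \<open>\<pi> (X\<^sub>i) (a i)\<close>. Only the values of \<open>c \<omega>\<close> on \<open>Z \<omega>\<close>
  matter.
\<close>

definition indep_labels ::
    "'w measure \<Rightarrow> ('w \<Rightarrow> 'a::euclidean_space set) \<Rightarrow> ('w \<Rightarrow> 'a \<Rightarrow> nat) \<Rightarrow> ('a \<Rightarrow> nat \<Rightarrow> real) \<Rightarrow> bool" where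
  "indep_labels M Z c \<pi> \<longleftrightarrow>
     (\<exists>X :: nat \<Rightarrow> 'w \<Rightarrow> 'a.
        (\<forall>i. X i \<in> points_algebra M Z \<rightarrow>\<^sub>M borel) \<and>
        (\<forall>\<omega>\<in>space M. bij_betw (\<lambda>i. X i \<omega>) {..<card (Z \<omega>)} (Z \<omega>)) \<and>
        (\<forall>i j. {\<omega>\<in>space M. i < card (Z \<omega>) \<and> c \<omega> (X i \<omega>) = j} \<in> sets M) \<and>
        (\<forall>a :: nat \<Rightarrow> nat. AE \<omega> in M.
           real_cond_exp M (points_algebra M Z)
             (indicat_real {\<omega>\<in>space M. \<forall>i<card (Z \<omega>). c \<omega> (X i \<omega>) = a i}) \<omega> =
           (\<Prod>i<card (Z \<omega>). \<pi> (X i \<omega>) (a i))))"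

definition label_prob ::
    "real \<Rightarrow> real \<Rightarrow> ('a \<Rightarrow> real) \<Rightarrow> ('a \<Rightarrow> real) \<Rightarrow> 'a \<Rightarrow> nat \<Rightarrow> real" where
  "label_prob n1 n2 f g z j =
     (if j = 1 then n1 * f z / (n1 * f z + n2 * g z)
      else if j = 2 then n2 * g z / (n1 * f z + n2 * g z)
      else 0)"

text \<open>
  Directed \<open>K\<close>-nearest-neighbor graph: \<open>b\<close> is one of the \<open>K\<close> closest points to \<open>a\<close> if fewer than
  \<open>K\<close> other points are strictly closer to \<open>a\<close>. Equidistant points are thus all admitted together.
\<close>

definition knn_edges :: "nat \<Rightarrow> 'a::metric_space set \<Rightarrow> ('a \<times> 'a) set" where
  "knn_edges K S =
     {(a, b). a \<in> S \<and> b \<in> S \<and> a \<noteq> b \<and> card {z \<in> S - {a}. dist a z < dist a b} < K}"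

definition cross_edge_count :: "'a set \<Rightarrow> ('a \<Rightarrow> nat) \<Rightarrow> ('a \<times> 'a) set \<Rightarrow> real" where
  "cross_edge_count S c E =
     (\<Sum>x\<in>S. \<Sum>y\<in>S. of_bool (c x = 1 \<and> c y = 2) * of_bool ((x, y) \<in> E))"

text \<open>Division by zero makes the integrand \<open>0\<close> where \<open>f = g = 0\<close>.\<close>

definition henze_penrose ::
    "('a::euclidean_space \<Rightarrow> real) \<Rightarrow> ('a \<Rightarrow> real) \<Rightarrow> real \<Rightarrow> real" where
  "henze_penrose f g p =
     p * (1 - p) * (LINT x|lborel. f x * g x / (p * f x + (1 - p) * g x))"

text \<open>
  Convergence in probability to a constant, each random variable living on its own space.
  Measurability is part of the notion, since \<^const>\<open>measure\<close> is \<open>0\<close> on non-measurable sets.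
\<close>

definition tendsto_in_probability ::
    "(nat \<Rightarrow> 'w measure) \<Rightarrow> (nat \<Rightarrow> 'w \<Rightarrow> real) \<Rightarrow> real \<Rightarrow> bool" where
  "tendsto_in_probability M X l \<longleftrightarrow>
     (\<forall>\<^sub>F N in sequentially. X N \<in> borel_measurable (M N)) \<and>
     (\<forall>\<epsilon>>0. (\<lambda>N. measure (M N) {\<omega>\<in>space (M N). \<bar>X N \<omega> - l\<bar> > \<epsilon>}) \<longlonglongrightarrow> 0)"

end

theory Submission
  imports Defs
begin

text \<open>
  Convergence in probability is convergence along a filter, and given the event that the counts of
  finitely many sets are close to their means the argument is deterministic. Let \<open>\<phi> = p f + q g\<close>,
  \<open>a = p f / \<phi>\<close>, \<open>h = q g / \<phi>\<close>. Given the points, changing one label changes \<open>T\<close> by at most the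
  degree of the point, which is \<open>O(k)\<close> because the in-degree is bounded by a dimensional constant
  times \<open>k\<close> (cover the directions by narrow cones). So \<open>T\<close> has conditional variance \<open>O(N k\<^sup>2)\<close>, and
  may be replaced by its conditional mean, the sum of about \<open>a x * h y\<close> over the edges \<open>(x, y)\<close>.

  As \<open>k = o(N)\<close>, all but a small fraction of the points lie in a bounded region and in small balls
  with more than \<open>k\<close> points, so that the edges leaving them are short. With \<open>h\<close> approximated in
  \<open>L\<^sup>1(\<phi>)\<close> by a uniformly continuous function, the in-degree bound allows \<open>h y\<close> to be replaced by
  \<open>h x\<close>. Almost surely there are no ties and every out-degree is \<open>k\<close>, which leaves \<open>k\<close> times the
  sum of \<open>a x * h x\<close> over the points; by the law of large numbers it is close to
  \<open>N k \<integral> a h \<phi> = N k \<delta>(f, g, p)\<close>.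
\<close>

subsection \<open>Functions of independent two-valued labels\<close>

text \<open>The densities are arbitrary, so \<open>h\<close> need not be continuous anywhere and
  cannot be compared along short edges directly; only its continuous approximation can. The error of
  that approximation is small on average over points, whereas the endpoint of an edge occurs once
  per incoming edge. The in-degree bound converts one average into the other, just as it controls
  the effect of a label in the variance estimate. That estimate, divided by
  \<open>(N k)\<^sup>2\<close>, is of order \<open>1 / N\<close> however \<open>k\<close> grows, so
  bounded and unbounded \<open>k\<close> are treated alike.

  The process is known only through its counts in Borel sets. Events such as the absence of ties or
  a small number of long edges are not obviously measurable; covering their failure by measurable
  sets of small probability avoids the question. The number of points is random as well, so the
  labels are averaged separately on each event \<open>card (Z \<omega>) = m\<close> with
  \<open>m \<le> 2 N\<close>, where their law is a finite product and every average is a finite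
  sum.\<close>

definition subset_mean :: "('i \<Rightarrow> real) \<Rightarrow> 'i set \<Rightarrow> ('i set \<Rightarrow> real) \<Rightarrow> real" where
  "subset_mean \<alpha> I F = (\<Sum>S\<in>Pow I. (\<Prod>i\<in>S. \<alpha> i) * (\<Prod>i\<in>I - S. 1 - \<alpha> i) * F S)"

lemma subset_mean_empty [simp]: "subset_mean \<alpha> {} F = F {}"
  by (simp add: subset_mean_def)

text \<open>\<open>subset_mean \<alpha> I F\<close> is the expectation of \<open>F\<close> at a
  random subset of \<open>I\<close> that contains each \<open>i\<close> independently with
  probability \<open>\<alpha> i\<close>. Conditioning on the membership of \<open>k\<close> gives
  the recursion behind the inductions below.\<close>

lemma subset_mean_insert:
  assumes "finite I" "k \<notin> I"
  shows "subset_mean \<alpha> (insert k I) F =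
    \<alpha> k * subset_mean \<alpha> I (\<lambda>S. F (insert k S)) + (1 - \<alpha> k) * subset_mean \<alpha> I F"
proof -
  let ?g = "\<lambda>S. (\<Prod>i\<in>S. \<alpha> i) * (\<Prod>i\<in>insert k I - S. 1 - \<alpha> i) * F S"
  have inj: "inj_on (insert k) (Pow I)"
    using assms by (intro inj_onI) (auto simp: insert_ident)
  have "subset_mean \<alpha> (insert k I) F = (\<Sum>S\<in>Pow I. ?g S) + (\<Sum>S\<in>insert k ` Pow I. ?g S)"
    unfolding subset_mean_def Pow_insert using assms by (intro sum.union_disjoint) auto
  also have "(\<Sum>S\<in>insert k ` Pow I. ?g S) = (\<Sum>S\<in>Pow I. ?g (insert k S))"
    using inj by (simp add: sum.reindex)
  also have "\<dots> = \<alpha> k * subset_mean \<alpha> I (\<lambda>S. F (insert k S))"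
    unfolding subset_mean_def sum_distrib_left
  proof (rule sum.cong)
    fix S assume S: "S \<in> Pow I"
    then have "finite S" "k \<notin> S" "insert k I - insert k S = I - S"
      using assms finite_subset by auto
    then show "?g (insert k S) = \<alpha> k * ((\<Prod>i\<in>S. \<alpha> i) * (\<Prod>i\<in>I - S. 1 - \<alpha> i) * F (insert k S))"
      by (simp add: mult.assoc)
  qed simp
  also have "(\<Sum>S\<in>Pow I. ?g S) = (1 - \<alpha> k) * subset_mean \<alpha> I F"
    unfolding subset_mean_def sum_distrib_left
  proof (rule sum.cong)
    fix S assume S: "S \<in> Pow I"
    then have "insert k I - S = insert k (I - S)" using assms by auto
    then show "?g S = (1 - \<alpha> k) * ((\<Prod>i\<in>S. \<alpha> i) * (\<Prod>i\<in>I - S. 1 - \<alpha> i) * F S)"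
      using assms by (simp add: mult_ac)
  qed simp
  finally show ?thesis by simp
qed

lemma subset_mean_cong:
  "(\<And>S. S \<subseteq> I \<Longrightarrow> F S = G S) \<Longrightarrow> subset_mean \<alpha> I F = subset_mean \<alpha> I G"
  by (auto simp: subset_mean_def intro!: sum.cong)

lemma subset_mean_const: "finite I \<Longrightarrow> subset_mean \<alpha> I (\<lambda>_. c) = c"
  by (induction I rule: finite_induct) (simp_all add: subset_mean_insert algebra_simps)

lemma subset_mean_add: "subset_mean \<alpha> I (\<lambda>S. F S + G S) = subset_mean \<alpha> I F + subset_mean \<alpha> I G"
  by (simp add: subset_mean_def algebra_simps sum.distrib)

lemma subset_mean_cmult: "subset_mean \<alpha> I (\<lambda>S. b * F S) = b * subset_mean \<alpha> I F"
  by (simp add: subset_mean_def sum_distrib_left mult_ac)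

lemma subset_mean_sum:
  "subset_mean \<alpha> I (\<lambda>S. \<Sum>j\<in>J. F j S) = (\<Sum>j\<in>J. subset_mean \<alpha> I (F j))"
  unfolding subset_mean_def sum_distrib_left by (rule sum.swap)

lemma subset_mean_mono:
  assumes "\<And>i. i \<in> I \<Longrightarrow> 0 \<le> \<alpha> i \<and> \<alpha> i \<le> 1" "\<And>S. S \<subseteq> I \<Longrightarrow> F S \<le> G S"
  shows "subset_mean \<alpha> I F \<le> subset_mean \<alpha> I G"
  unfolding subset_mean_def
  using assms by (intro sum_mono mult_left_mono mult_nonneg_nonneg prod_nonneg) auto

lemma subset_mean_variance:
  assumes "finite I" "\<And>i. i \<in> I \<Longrightarrow> 0 \<le> \<alpha> i \<and> \<alpha> i \<le> 1"
  shows "subset_mean \<alpha> I (\<lambda>S. (F S - subset_mean \<alpha> I F)\<^sup>2) =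
    subset_mean \<alpha> I (\<lambda>S. (F S)\<^sup>2) - (subset_mean \<alpha> I F)\<^sup>2"
proof -
  define m where "m = subset_mean \<alpha> I F"
  define b c where "b = - 2 * m" "c = m\<^sup>2"
  have "(\<lambda>S. (F S - m)\<^sup>2) = (\<lambda>S. (F S)\<^sup>2 + (b * F S + c))"
    by (auto simp: b_c_def power2_eq_square algebra_simps)
  then have "subset_mean \<alpha> I (\<lambda>S. (F S - m)\<^sup>2) = subset_mean \<alpha> I (\<lambda>S. (F S)\<^sup>2) + (b * m + c)"
    using assms(1) by (simp add: subset_mean_add subset_mean_cmult subset_mean_const m_def)
  then show ?thesis by (simp add: b_c_def power2_eq_square flip: m_def)
qed

text \<open>A bound of Efron-Stein type. By the law of total variance, splitting off a coordinate
  \<open>k\<close> leaves a convex combination of two conditional variances, bounded by induction,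
  plus the variance of a two-valued variable whose values differ by at most
  \<open>b k\<close>.\<close>

lemma bounded_difference_variance:
  assumes "finite I" "\<And>i. i \<in> I \<Longrightarrow> 0 \<le> \<alpha> i \<and> \<alpha> i \<le> 1"
    and "\<And>i S. i \<in> I \<Longrightarrow> S \<subseteq> I \<Longrightarrow> i \<notin> S \<Longrightarrow> \<bar>F (insert i S) - F S\<bar> \<le> b i"
  shows "subset_mean \<alpha> I (\<lambda>S. (F S - subset_mean \<alpha> I F)\<^sup>2) \<le> (\<Sum>i\<in>I. (b i)\<^sup>2)"
proof -
  have "subset_mean \<alpha> I (\<lambda>S. (F S)\<^sup>2) - (subset_mean \<alpha> I F)\<^sup>2 \<le> (\<Sum>i\<in>I. (b i)\<^sup>2)"
    using assms
  proof (induction I arbitrary: F rule: finite_induct)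
    case empty
    then show ?case by simp
  next
    case (insert k I)
    let ?F1 = "\<lambda>S. F (insert k S)"
    \<comment> \<open>\<open>x\<close>, \<open>s\<close> are the first and second moments of
      \<open>F\<close> given that \<open>k\<close> is chosen, \<open>y\<close>, \<open>t\<close>
      those given that it is not.\<close>
    define x y s t V where "x = subset_mean \<alpha> I ?F1" "y = subset_mean \<alpha> I F"
      "s = subset_mean \<alpha> I (\<lambda>S. (?F1 S)\<^sup>2)" "t = subset_mean \<alpha> I (\<lambda>S. (F S)\<^sup>2)"
      "V = (\<Sum>i\<in>I. (b i)\<^sup>2)"
    note defs = this
    have a: "0 \<le> \<alpha> k" "\<alpha> k \<le> 1" using insert.prems(1)[of k] by auto
    have "s - x\<^sup>2 \<le> V" unfolding defs
    proof (rule insert.IH)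
      fix i S assume *: "i \<in> I" "S \<subseteq> I" "i \<notin> S"
      then show "\<bar>F (insert k (insert i S)) - F (insert k S)\<bar> \<le> b i"
        using insert.prems(2)[of i "insert k S"] insert.hyps by (auto simp: insert_commute)
    qed (use insert.prems in auto)
    moreover have "t - y\<^sup>2 \<le> V" unfolding defs
      by (rule insert.IH) (use insert.prems in \<open>auto simp: subset_insertI2\<close>)
    ultimately have V: "\<alpha> k * (s - x\<^sup>2) + (1 - \<alpha> k) * (t - y\<^sup>2) \<le> V"
      using a by (intro convex_bound_le) auto
    have diff: "x - y = subset_mean \<alpha> I (\<lambda>S. ?F1 S - F S)"
      by (simp add: defs subset_mean_def sum_subtractf right_diff_distrib)
    have *: "\<bar>?F1 S - F S\<bar> \<le> b k" if "S \<subseteq> I" for S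
      using insert.prems(2)[of k S] insert.hyps that by auto
    have \<alpha>: "0 \<le> \<alpha> i \<and> \<alpha> i \<le> 1" if "i \<in> I" for i using insert.prems(1) that by blast
    have "x - y \<le> subset_mean \<alpha> I (\<lambda>_. b k)"
      unfolding diff by (rule subset_mean_mono[OF \<alpha> abs_le_D1[OF *]])
    moreover have "subset_mean \<alpha> I (\<lambda>_. - b k) \<le> x - y"
      unfolding diff by (rule subset_mean_mono[OF \<alpha>]) (metis * abs_le_D2 minus_le_iff)+
    ultimately have "\<bar>x - y\<bar> \<le> b k"
      using insert.hyps by (simp add: subset_mean_const)
    then have xy: "(x - y)\<^sup>2 \<le> (b k)\<^sup>2" by (metis abs_ge_zero power2_abs power_mono)
    have aa: "0 \<le> \<alpha> k * (1 - \<alpha> k)" "\<alpha> k * (1 - \<alpha> k) \<le> 1"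
      using a by (auto intro: mult_le_one)
    have "\<alpha> k * (1 - \<alpha> k) * (x - y)\<^sup>2 \<le> 1 * (x - y)\<^sup>2"
      using aa by (intro mult_right_mono) auto
    then have "\<alpha> k * (1 - \<alpha> k) * (x - y)\<^sup>2 \<le> (b k)\<^sup>2" using xy by linarith
    moreover have "\<alpha> k * s + (1 - \<alpha> k) * t - (\<alpha> k * x + (1 - \<alpha> k) * y)\<^sup>2 =
      (\<alpha> k * (s - x\<^sup>2) + (1 - \<alpha> k) * (t - y\<^sup>2)) + \<alpha> k * (1 - \<alpha> k) * (x - y)\<^sup>2"
      by (simp add: power2_eq_square algebra_simps)
    ultimately show ?case
      using V insert.hyps by (simp add: subset_mean_insert flip: defs)
  qed
  then show ?thesis using assms by (simp add: subset_mean_variance)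
qed

lemma subset_mean_pair:
  assumes "finite I" "i \<in> I" "j \<in> I" "i \<noteq> j"
  shows "subset_mean \<alpha> I (\<lambda>S. of_bool (i \<in> S \<and> j \<notin> S)) = \<alpha> i * (1 - \<alpha> j)"
proof -
  define J where "J = I - {i, j}"
  have I: "I = insert i (insert j J)" and J: "finite J" "i \<notin> J" "j \<notin> J"
    using assms by (auto simp: J_def)
  have 1: "subset_mean \<alpha> J (\<lambda>S. of_bool (i \<in> insert i (insert j S) \<and> j \<notin> insert i (insert j S))) = 0"
    "subset_mean \<alpha> J (\<lambda>S. of_bool (i \<in> insert j S \<and> j \<notin> insert j S)) = 0"
    by (simp_all add: subset_mean_def)
  have 2: "subset_mean \<alpha> J (\<lambda>S. of_bool (i \<in> insert i S \<and> j \<notin> insert i S)) = 1"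
    using J assms(4) by (subst subset_mean_cong[where G = "\<lambda>_. 1"]) (auto simp: subset_mean_const)
  have 3: "subset_mean \<alpha> J (\<lambda>S. of_bool (i \<in> S \<and> j \<notin> S)) = 0"
    using J assms(4) by (subst subset_mean_cong[where G = "\<lambda>_. 0"]) (auto simp: subset_mean_const)
  show ?thesis
    unfolding I using J assms(4) 1 2 3 by (simp add: subset_mean_insert)
qed

text \<open>The count of edges from label 1 to label 2, as a function of the set of indices with label 1.\<close>
definition cut_size :: "('i \<times> 'i) set \<Rightarrow> 'i set \<Rightarrow> 'i set \<Rightarrow> real" where
  "cut_size E I S = (\<Sum>i\<in>I. \<Sum>j\<in>I. of_bool (i \<in> S \<and> j \<notin> S) * of_bool ((i, j) \<in> E))"

lemma cut_size_bounds:
  assumes "finite I" shows "0 \<le> cut_size E I S" "cut_size E I S \<le> (real (card I))\<^sup>2"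
proof -
  show "0 \<le> cut_size E I S" unfolding cut_size_def by (intro sum_nonneg) auto
  have "cut_size E I S \<le> (\<Sum>i\<in>I. \<Sum>j\<in>I. 1)" unfolding cut_size_def by (intro sum_mono) auto
  then show "cut_size E I S \<le> (real (card I))\<^sup>2" by (simp add: power2_eq_square)
qed

lemma cut_size_mean:
  assumes "finite I" "irrefl E"
  shows "subset_mean \<alpha> I (cut_size E I) = (\<Sum>i\<in>I. \<Sum>j\<in>I. \<alpha> i * (1 - \<alpha> j) * of_bool ((i, j) \<in> E))"
proof -
  have *: "cut_size E I = (\<lambda>S. \<Sum>i\<in>I. \<Sum>j\<in>I. of_bool ((i, j) \<in> E) * of_bool (i \<in> S \<and> j \<notin> S))"
    by (auto simp: cut_size_def mult.commute)
  show ?thesis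
    unfolding * subset_mean_sum subset_mean_cmult
  proof (intro sum.cong refl)
    fix i j assume "i \<in> I" "j \<in> I"
    \<comment> \<open>On the diagonal the product formula would be wrong, but irreflexivity of
      \<open>E\<close> removes these terms.\<close>
    then show "of_bool ((i, j) \<in> E) * subset_mean \<alpha> I (\<lambda>S. of_bool (i \<in> S \<and> j \<notin> S)) =
      \<alpha> i * (1 - \<alpha> j) * of_bool ((i, j) \<in> E)"
      using assms subset_mean_pair[of I i j \<alpha>] by (cases "i = j") (auto simp: irrefl_def)
  qed
qed

text \<open>Only edges with an endpoint \<open>k\<close> can change their contribution, each by at
  most 1.\<close>

lemma cut_size_insert:
  assumes "finite I" "k \<in> I" "k \<notin> S"
    "card {j\<in>I. (k, j) \<in> E} + card {i\<in>I. (i, k) \<in> E} \<le> b"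
  shows "\<bar>cut_size E I (insert k S) - cut_size E I S\<bar> \<le> real b"
proof -
  have "\<bar>cut_size E I (insert k S) - cut_size E I S\<bar>
      \<le> (\<Sum>i\<in>I. \<Sum>j\<in>I. \<bar>of_bool (i \<in> insert k S \<and> j \<notin> insert k S) * of_bool ((i, j) \<in> E)
                   - of_bool (i \<in> S \<and> j \<notin> S) * of_bool ((i, j) \<in> E) :: real\<bar>)"
    unfolding cut_size_def sum_subtractf[symmetric] by (intro order_trans[OF sum_abs] sum_mono sum_abs)
  also have "\<dots> \<le> (\<Sum>i\<in>I. \<Sum>j\<in>I. of_bool (i = k) * of_bool ((k, j) \<in> E) + of_bool (j = k) * of_bool ((i, k) \<in> E))"
    using assms by (intro sum_mono) auto
  also have "\<dots> = real (card {j\<in>I. (k, j) \<in> E}) + real (card {i\<in>I. (i, k) \<in> E})"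
  proof -
    have "(\<Sum>i\<in>I. \<Sum>j\<in>I. of_bool (i = k) * of_bool ((k, j) \<in> E)) = (\<Sum>j\<in>I. of_bool ((k, j) \<in> E) :: real)"
      using assms by (simp add: sum_of_bool_mult_eq Int_def conj_commute cong: conj_cong flip: sum_distrib_left)
    moreover have "(\<Sum>i\<in>I. \<Sum>j\<in>I. of_bool (j = k) * of_bool ((i, k) \<in> E)) = (\<Sum>i\<in>I. of_bool ((i, k) \<in> E) :: real)"
      using assms by (simp add: sum_of_bool_mult_eq Int_def conj_commute cong: conj_cong flip: sum_distrib_right)
    ultimately show ?thesis
      using assms(1) by (simp add: sum.distrib of_bool_def sum.If_cases Int_def)
  qed
  finally show ?thesis using assms(4) by linarith
qed

lemma cut_size_variance:
  assumes "finite I" "irrefl E" "\<And>i. i \<in> I \<Longrightarrow> 0 \<le> \<alpha> i \<and> \<alpha> i \<le> 1"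
    and "\<And>k. k \<in> I \<Longrightarrow> card {j\<in>I. (k, j) \<in> E} + card {i\<in>I. (i, k) \<in> E} \<le> b"
  shows "subset_mean \<alpha> I (\<lambda>S. (cut_size E I S -
      (\<Sum>i\<in>I. \<Sum>j\<in>I. \<alpha> i * (1 - \<alpha> j) * of_bool ((i, j) \<in> E)))\<^sup>2) \<le> real (card I) * (real b)\<^sup>2"
proof -
  have "\<bar>cut_size E I (insert k S) - cut_size E I S\<bar> \<le> real b" if "k \<in> I" "k \<notin> S" for k S
    using assms that by (intro cut_size_insert) auto
  then show ?thesis
    using bounded_difference_variance[of I \<alpha> "cut_size E I" "\<lambda>_. real b"] assms(1,3)
    by (simp add: cut_size_mean[OF assms(1,2)])
qed

subsection \<open>Degrees in nearest-neighbor graphs\<close>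

text \<open>\<open>C\<close> is the number of balls of radius 1/2 needed to cover the unit sphere.
  Among the in-neighbors of \<open>y\<close> whose direction from \<open>y\<close> lies in one such
  ball, take the farthest one, \<open>x\<close>: all the others are closer to \<open>x\<close> than
  \<open>y\<close> is, so there are fewer than \<open>K\<close> of them.\<close>

lemma knn_indegree_bound:
  obtains C :: nat where
    "\<And>K S (y :: 'a :: euclidean_space). finite S \<Longrightarrow> card {x. (x, y) \<in> knn_edges K S} \<le> C * K"
proof -
  \<comment> \<open>Radius 1/2 makes two unit vectors in the same ball less than 1 apart, that is,
    at an angle below 60 degrees.\<close>
  have "sphere (0::'a) 1 \<subseteq> (\<Union>d\<in>UNIV. ball d (1/2))" using centre_in_ball[of _ "1/2"] by fastforce
  then obtain D where D: "finite D" "sphere (0::'a) 1 \<subseteq> (\<Union>d\<in>D. ball d (1/2))"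
    by (metis compact_sphere compactE_image[of "sphere (0::'a) 1" UNIV "\<lambda>d. ball d (1/2)"] open_ball)
  have "card {x. (x, y) \<in> knn_edges K S} \<le> card D * K" if S: "finite S" for K S and y :: 'a
  proof -
    define Q where "Q d = {x. (x, y) \<in> knn_edges K S \<and> (x - y) /\<^sub>R norm (x - y) \<in> ball d (1/2)}" for d
    have finQ: "finite (Q d)" for d
      by (rule finite_subset[OF _ S]) (auto simp: Q_def knn_edges_def)
    have "{x. (x, y) \<in> knn_edges K S} \<subseteq> (\<Union>d\<in>D. Q d)"
    proof
      fix x assume x: "x \<in> {x. (x, y) \<in> knn_edges K S}"
      then have "(x - y) /\<^sub>R norm (x - y) \<in> sphere 0 1" by (auto simp: knn_edges_def)
      then have "(x - y) /\<^sub>R norm (x - y) \<in> (\<Union>d\<in>D. ball d (1/2))" using D(2) by blast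
      then show "x \<in> (\<Union>d\<in>D. Q d)" using x unfolding Q_def by blast
    qed
    then have "card {x. (x, y) \<in> knn_edges K S} \<le> card (\<Union>d\<in>D. Q d)"
      using D(1) finQ by (intro card_mono) auto
    also have "\<dots> \<le> (\<Sum>d\<in>D. card (Q d))" by (rule card_UN_le[OF D(1)])
    also have "\<dots> \<le> (\<Sum>d\<in>D. K)"
    proof (rule sum_mono)
      fix d
      show "card (Q d) \<le> K"
      proof (cases "Q d = {}")
        case False
        let ?M = "Max ((\<lambda>x. dist x y) ` Q d)"
        have "?M \<in> (\<lambda>x. dist x y) ` Q d" using finQ False by (intro Max_in) auto
        then obtain x where x: "x \<in> Q d" "dist x y = ?M" by auto
        have max: "dist z y \<le> dist x y" if "z \<in> Q d" for z
          unfolding x(2) using finQ that by (intro Max_ge) auto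
        have "Q d - {x} \<subseteq> {z \<in> S - {x}. dist x z < dist x y}"
        proof
          fix z assume z: "z \<in> Q d - {x}"
          define r s where "r = norm (x - y)" "s = norm (z - y)"
          note rs = this
          have zS: "z \<in> S" "z \<noteq> y" using z by (auto simp: Q_def knn_edges_def)
          have s: "0 < s" "s \<le> r" using zS max[of z] z by (auto simp: rs dist_norm)
          have "dist ((x - y) /\<^sub>R r) ((z - y) /\<^sub>R s) < 1"
            using x z unfolding Q_def rs
            by (auto intro: dist_triangle_half_r)
          then have "norm ((x - y) /\<^sub>R r - (z - y) /\<^sub>R s) < 1" by (simp add: dist_norm)
          then have *: "s * norm ((x - y) /\<^sub>R r - (z - y) /\<^sub>R s) < s" using s by simp
          have "norm (x - y) \<noteq> 0" using s by (auto simp: rs)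
          then have "norm ((x - y) /\<^sub>R r) = 1" by (simp add: rs(1))
          \<comment> \<open>Walk from \<open>z\<close> out to distance \<open>r\<close> in the
            direction of \<open>x\<close>: the radial part has length \<open>r - s\<close>, and the
            change of direction at distance \<open>s\<close> costs less than \<open>s\<close>. The
            total is below \<open>r\<close>, the distance of \<open>x\<close> to
            \<open>y\<close>.\<close>
          have "x - z = (r - s) *\<^sub>R ((x - y) /\<^sub>R r) + s *\<^sub>R ((x - y) /\<^sub>R r - (z - y) /\<^sub>R s)"
            using s by (simp add: algebra_simps)
          then have "norm (x - z) \<le> norm ((r - s) *\<^sub>R ((x - y) /\<^sub>R r)) + norm (s *\<^sub>R ((x - y) /\<^sub>R r - (z - y) /\<^sub>R s))"
            by (metis norm_triangle_ineq)
          also have "\<dots> = (r - s) + s * norm ((x - y) /\<^sub>R r - (z - y) /\<^sub>R s)"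
            using s \<open>norm ((x - y) /\<^sub>R r) = 1\<close> by simp
          also have "\<dots> < r" using * by simp
          finally show "z \<in> {z \<in> S - {x}. dist x z < dist x y}"
            using z zS by (simp add: rs dist_norm)
        qed
        then have "card (Q d - {x}) \<le> card {z \<in> S - {x}. dist x z < dist x y}"
          using S by (intro card_mono) auto
        also have "\<dots> < K" using x by (auto simp: Q_def knn_edges_def)
        finally show ?thesis using x finQ by (simp add: card_Diff_singleton_if split: if_splits)
      qed simp
    qed
    finally show ?thesis by simp
  qed
  then show thesis by (rule that)
qed

text \<open>For injective \<open>f\<close> the number of smaller elements is a rank, a bijection
  from \<open>T\<close> onto the numbers below \<open>card T\<close>.\<close>

lemma card_rank_less:
  fixes f :: "'a \<Rightarrow> 'b :: linorder"
  assumes "finite T" "inj_on f T"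
  shows "card {y\<in>T. card {z\<in>T. f z < f y} < K} = min K (card T)"
proof -
  define r where "r y = card {z\<in>T. f z < f y}" for y
  have mono: "r x < r y" if "x \<in> T" "y \<in> T" "f x < f y" for x y
    unfolding r_def using assms(1) that by (intro psubset_card_mono) auto
  have inj: "inj_on r T"
    by (intro inj_onI) (metis mono assms(2) inj_on_def less_irrefl linorder_less_linear)
  have sub: "r ` T \<subseteq> {..<card T}"
    unfolding r_def using assms(1) by (auto intro!: psubset_card_mono)
  have rT: "r ` T = {..<card T}"
    using sub inj by (intro card_subset_eq) (auto simp: card_image)
  have "card {y\<in>T. r y < K} = card (r ` {y\<in>T. r y < K})"
    using inj by (intro card_image[symmetric]) (auto simp: inj_on_def)
  also have "r ` {y\<in>T. r y < K} = r ` T \<inter> {..<K}" by auto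
  also have "\<dots> = {..<min K (card T)}" using rT by auto
  finally show ?thesis by (simp add: r_def)
qed

definition tie_free :: "'a::metric_space set \<Rightarrow> bool" where
  "tie_free S \<longleftrightarrow> (\<forall>a\<in>S. inj_on (dist a) (S - {a}))"

lemma knn_outdegree:
  assumes "finite S" "tie_free S" "a \<in> S"
  shows "card {y. (a, y) \<in> knn_edges K S} = min K (card S - 1)"
proof -
  have "{y. (a, y) \<in> knn_edges K S} = {y\<in>S - {a}. card {z\<in>S - {a}. dist a z < dist a y} < K}"
    using assms(3) by (auto simp: knn_edges_def)
  then show ?thesis
    using card_rank_less[of "S - {a}" "dist a" K] assms by (simp add: tie_free_def)
qed

text \<open>The conditional mean of \<open>cross_edge_count\<close> given the points: the endpoints
  of an edge are distinct, so their labels are independent.\<close>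

definition mean_cross_edges :: "'a set \<Rightarrow> ('a \<Rightarrow> nat \<Rightarrow> real) \<Rightarrow> ('a \<times> 'a) set \<Rightarrow> real" where
  "mean_cross_edges S \<pi> E = (\<Sum>x\<in>S. \<Sum>y\<in>S. \<pi> x 1 * \<pi> y 2 * of_bool ((x, y) \<in> E))"

subsection \<open>Convergence in probability as a filter\<close>

text \<open>
  A property of pairs \<open>(N, \<omega>)\<close> holds eventually in this filter if its failure has outer probability
  tending to \<open>0\<close>; limits along the filter are limits in probability.
\<close>
definition in_prob :: "(nat \<Rightarrow> 'w measure) \<Rightarrow> (nat \<times> 'w) filter" where
  "in_prob M = Abs_filter (\<lambda>P. \<forall>e>0. \<forall>\<^sub>F N in sequentially.
     \<exists>B\<in>sets (M N). measure (M N) B \<le> e \<and> (\<forall>\<omega>\<in>space (M N) - B. P (N, \<omega>)))"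

lemma eventually_in_prob:
  "eventually P (in_prob M) \<longleftrightarrow> (\<forall>e>0. \<forall>\<^sub>F N in sequentially.
     \<exists>B\<in>sets (M N). measure (M N) B \<le> e \<and> (\<forall>\<omega>\<in>space (M N) - B. P (N, \<omega>)))"
  unfolding in_prob_def
proof (rule eventually_Abs_filter, rule is_filter.intro)
  show "\<forall>e>0. \<forall>\<^sub>F N in sequentially.
     \<exists>B\<in>sets (M N). measure (M N) B \<le> e \<and> (\<forall>\<omega>\<in>space (M N) - B. True)"
    by (auto intro!: always_eventually bexI[of _ "{}"])
next
  fix P Q
  assume P: "\<forall>e>0. \<forall>\<^sub>F N in sequentially.
     \<exists>B\<in>sets (M N). measure (M N) B \<le> e \<and> (\<forall>\<omega>\<in>space (M N) - B. P (N, \<omega>))"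
    and Q: "\<forall>e>0. \<forall>\<^sub>F N in sequentially.
     \<exists>B\<in>sets (M N). measure (M N) B \<le> e \<and> (\<forall>\<omega>\<in>space (M N) - B. Q (N, \<omega>))"
  show "\<forall>e>0. \<forall>\<^sub>F N in sequentially.
     \<exists>B\<in>sets (M N). measure (M N) B \<le> e \<and> (\<forall>\<omega>\<in>space (M N) - B. P (N, \<omega>) \<and> Q (N, \<omega>))"
  proof (intro allI impI)
    fix e :: real assume e: "e > 0"
    \<comment> \<open>Each conjunct may fail with half of the allowed probability.\<close>
    have "\<forall>\<^sub>F N in sequentially.
      \<exists>B\<in>sets (M N). measure (M N) B \<le> e/2 \<and> (\<forall>\<omega>\<in>space (M N) - B. P (N, \<omega>))"
      "\<forall>\<^sub>F N in sequentially.
      \<exists>B\<in>sets (M N). measure (M N) B \<le> e/2 \<and> (\<forall>\<omega>\<in>space (M N) - B. Q (N, \<omega>))"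
      using P Q half_gt_zero[OF e] by blast+
    then show "\<forall>\<^sub>F N in sequentially.
     \<exists>B\<in>sets (M N). measure (M N) B \<le> e \<and> (\<forall>\<omega>\<in>space (M N) - B. P (N, \<omega>) \<and> Q (N, \<omega>))"
    proof (eventually_elim)
      case (elim N)
      then obtain B C where BC: "B \<in> sets (M N)" "C \<in> sets (M N)"
        "measure (M N) B \<le> e/2" "measure (M N) C \<le> e/2"
        "\<forall>\<omega>\<in>space (M N) - B. P (N, \<omega>)" "\<forall>\<omega>\<in>space (M N) - C. Q (N, \<omega>)"
        using e by auto
      moreover have "measure (M N) (B \<union> C) \<le> e"
        using measure_Un_le[of B "M N" C] BC by linarith
      ultimately show ?case by (intro bexI[of _ "B \<union> C"]) auto
    qed
  qed
next
  fix P Q :: "nat \<times> 'a \<Rightarrow> bool"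
  assume PQ: "\<forall>x. P x \<longrightarrow> Q x" and P: "\<forall>e>0. \<forall>\<^sub>F N in sequentially.
     \<exists>B\<in>sets (M N). measure (M N) B \<le> e \<and> (\<forall>\<omega>\<in>space (M N) - B. P (N, \<omega>))"
  show "\<forall>e>0. \<forall>\<^sub>F N in sequentially.
     \<exists>B\<in>sets (M N). measure (M N) B \<le> e \<and> (\<forall>\<omega>\<in>space (M N) - B. Q (N, \<omega>))"
  proof (intro allI impI)
    fix e :: real assume "e > 0"
    with P have "\<forall>\<^sub>F N in sequentially.
     \<exists>B\<in>sets (M N). measure (M N) B \<le> e \<and> (\<forall>\<omega>\<in>space (M N) - B. P (N, \<omega>))" by blast
    then show "\<forall>\<^sub>F N in sequentially.
     \<exists>B\<in>sets (M N). measure (M N) B \<le> e \<and> (\<forall>\<omega>\<in>space (M N) - B. Q (N, \<omega>))"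
      by eventually_elim (use PQ in blast)
  qed
qed

lemma filterlim_fst_in_prob: "filterlim fst sequentially (in_prob M)"
  unfolding filterlim_iff eventually_in_prob
proof (intro allI impI)
  fix P and e :: real assume "eventually P sequentially" "e > 0"
  from this(1) show "\<forall>\<^sub>F N in sequentially.
     \<exists>B\<in>sets (M N). measure (M N) B \<le> e \<and> (\<forall>\<omega>\<in>space (M N) - B. P (fst (N, \<omega>)))"
    by eventually_elim (use \<open>e > 0\<close> in \<open>auto intro!: bexI[of _ "{}"]\<close>)
qed

lemma eventually_fst_in_prob:
  "eventually P sequentially \<Longrightarrow> \<forall>\<^sub>F x in in_prob M. P (fst x)"
  using filterlim_fst_in_prob[of M] by (simp add: filterlim_iff)

lemma tendsto_fst_in_prob: "X \<longlonglongrightarrow> l \<Longrightarrow> ((\<lambda>x. X (fst x)) \<longlongrightarrow> l) (in_prob M)"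
  by (rule filterlim_compose[OF _ filterlim_fst_in_prob])

lemma eventually_space_in_prob: "\<forall>\<^sub>F x in in_prob M. snd x \<in> space (M (fst x))"
  unfolding eventually_in_prob by (auto intro!: always_eventually bexI[of _ "{}"])

lemma eventually_in_prob_AE:
  assumes "\<forall>\<^sub>F N in sequentially. AE \<omega> in M N. P (N, \<omega>)"
  shows "eventually P (in_prob M)"
  unfolding eventually_in_prob
proof (intro allI impI)
  fix e :: real assume "e > 0"
  from assms show "\<forall>\<^sub>F N in sequentially.
     \<exists>B\<in>sets (M N). measure (M N) B \<le> e \<and> (\<forall>\<omega>\<in>space (M N) - B. P (N, \<omega>))"
  proof eventually_elim
    case (elim N)
    then obtain B where "{\<omega>\<in>space (M N). \<not> P (N, \<omega>)} \<subseteq> B" "emeasure (M N) B = 0" "B \<in> sets (M N)"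
      by (rule AE_E)
    then show ?case using \<open>e > 0\<close> by (intro bexI[of _ B]) (auto simp: measure_def)
  qed
qed

lemma eventually_in_probI:
  assumes "\<forall>\<^sub>F N in sequentially. B N \<in> sets (M N) \<and> measure (M N) (B N) \<le> r N \<and> 
      (\<forall>\<omega>\<in>space (M N) - B N. P (N, \<omega>))"
    and "r \<longlonglongrightarrow> 0"
  shows "eventually P (in_prob M)"
  unfolding eventually_in_prob
proof (intro allI impI)
  fix e :: real assume "e > 0"
  then have "\<forall>\<^sub>F N in sequentially. r N < e" using assms(2) by (simp add: order_tendstoD)
  with assms(1) show "\<forall>\<^sub>F N in sequentially.
     \<exists>B\<in>sets (M N). measure (M N) B \<le> e \<and> (\<forall>\<omega>\<in>space (M N) - B. P (N, \<omega>))"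
  proof eventually_elim
    case (elim N)
    then show ?case by (intro bexI[of _ "B N"]) auto
  qed
qed

text \<open>The way back from outer probability to \<open>measure\<close>: the deviation event lies
  in a measurable cover of small measure, and monotonicity of a finite measure does the
  rest.\<close>

lemma tendsto_in_probabilityI:
  assumes "\<forall>\<^sub>F N in sequentially. finite_measure (M N)"
    and "\<forall>\<^sub>F N in sequentially. X N \<in> borel_measurable (M N)"
    and "((\<lambda>(N, \<omega>). X N \<omega>) \<longlongrightarrow> l) (in_prob M)"
  shows "tendsto_in_probability M X l"
  unfolding tendsto_in_probability_def
proof (intro conjI allI impI assms(2))
  fix \<epsilon> :: real assume "\<epsilon> > 0"
  then have ev: "\<forall>\<^sub>F x in in_prob M. dist (X (fst x) (snd x)) l < \<epsilon>"
    using tendstoD[OF assms(3)] by (simp add: case_prod_unfold)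
  show "(\<lambda>N. measure (M N) {\<omega>\<in>space (M N). \<bar>X N \<omega> - l\<bar> > \<epsilon>}) \<longlonglongrightarrow> 0"
  proof (rule tendstoI)
    fix e :: real assume "e > 0"
    then have "\<forall>\<^sub>F N in sequentially. \<exists>B\<in>sets (M N). measure (M N) B \<le> e/2 \<and>
      (\<forall>\<omega>\<in>space (M N) - B. dist (X N \<omega>) l < \<epsilon>)"
      using ev half_gt_zero[of e] unfolding eventually_in_prob fst_conv snd_conv by blast
    with assms(1) show "\<forall>\<^sub>F N in sequentially. dist (measure (M N) {\<omega>\<in>space (M N). \<bar>X N \<omega> - l\<bar> > \<epsilon>}) 0 < e"
    proof eventually_elim
      case (elim N)
      then obtain B where B: "B \<in> sets (M N)" "measure (M N) B \<le> e/2"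
        "\<forall>\<omega>\<in>space (M N) - B. dist (X N \<omega>) l < \<epsilon>" by blast
      have "{\<omega>\<in>space (M N). \<bar>X N \<omega> - l\<bar> > \<epsilon>} \<subseteq> B"
      proof
        fix \<omega> assume "\<omega> \<in> {\<omega>\<in>space (M N). \<bar>X N \<omega> - l\<bar> > \<epsilon>}"
        then show "\<omega> \<in> B" using B(3)[rule_format, of \<omega>] by (cases "\<omega> \<in> B") (auto simp: dist_real_def)
      qed
      then have "measure (M N) {\<omega>\<in>space (M N). \<bar>X N \<omega> - l\<bar> > \<epsilon>} \<le> e/2"
        using finite_measure.finite_measure_mono[OF elim(1) _ B(1)] B(2) by (blast intro: order_trans)
      then show ?case using \<open>e > 0\<close> by simp
    qed
  qed
qed

subsection \<open>Counts of a Poisson process\<close>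

lemma
  assumes "poisson_process M Z u"
  shows poisson_process_prob_space: "prob_space M"
    and poisson_process_integrable: "integrable lborel u"
    and poisson_process_nonneg: "0 \<le> u x"
    and poisson_process_finite: "\<omega> \<in> space M \<Longrightarrow> finite (Z \<omega>)"
    and poisson_process_count_measurable:
      "A \<in> sets borel \<Longrightarrow> (\<lambda>\<omega>. card (Z \<omega> \<inter> A)) \<in> M \<rightarrow>\<^sub>M count_space UNIV"
    and poisson_process_prob: "A \<in> sets borel \<Longrightarrow> measure M {\<omega>\<in>space M. card (Z \<omega> \<inter> A) = n} =
        (LINT x:A|lborel. u x) ^ n / fact n * exp (- (LINT x:A|lborel. u x))"
  using assms by (simp_all add: poisson_process_def)

lemma poisson_process_indep:
  fixes I :: "nat set"
  assumes "poisson_process M Z u" "finite I" "\<forall>i\<in>I. A i \<in> sets borel" "disjoint_family_on A I"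
  shows "prob_space.indep_vars M (\<lambda>_. count_space UNIV) (\<lambda>i \<omega>. card (Z \<omega> \<inter> A i)) I"
proof -
  note assms(1)[unfolded poisson_process_def,
      THEN conjunct2, THEN conjunct2, THEN conjunct2, THEN conjunct2, THEN conjunct2, THEN conjunct2]
  from this[rule_format, of I A] show ?thesis using assms(2-4) by blast
qed

text \<open>The recurrence \<open>(n + 1) * a (n + 1) = m * a n\<close> reduces the first moment to
  the total mass and the second moment to the first. It holds for every real \<open>m\<close>, so a
  vanishing rate is no special case.\<close>

lemma poisson_variance_sums:
  fixes m :: real
  shows "(\<lambda>n. (real n - m)\<^sup>2 * (m ^ n / fact n * exp (- m))) sums m"
proof -
  define a where "a n = m ^ n / fact n" for n
  have a0: "a sums exp m"
    using exp_converges[of m] by (simp add: a_def[abs_def] field_simps)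
  have rec: "real (Suc n) * a (Suc n) = m * a n" for n
    by (simp add: a_def del: of_nat_Suc)
  have "(\<lambda>n. real (Suc n) * a (Suc n)) sums (m * exp m)"
    unfolding rec by (rule sums_mult[OF a0])
  then have a1: "(\<lambda>n. real n * a n) sums (m * exp m)"
    by (subst (asm) sums_Suc_iff) simp
  have "real (Suc n) * (real (Suc n) * a (Suc n)) = m * (real n * a n + a n)" for n
    unfolding rec by (simp add: algebra_simps)
  then have "(\<lambda>n. real (Suc n) * (real (Suc n) * a (Suc n))) sums (m * (m * exp m + exp m))"
    using sums_mult[OF sums_add[OF a1 a0], of m] by simp
  then have a2: "(\<lambda>n. real n * (real n * a n)) sums (m * (m * exp m + exp m))"
    by (subst (asm) sums_Suc_iff) simp
  have "(\<lambda>n. exp (- m) * (real n * (real n * a n) - 2 * m * (real n * a n) + m\<^sup>2 * a n)) sums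
    (exp (- m) * (m * (m * exp m + exp m) - 2 * m * (m * exp m) + m\<^sup>2 * exp m))"
    by (intro sums_mult sums_add sums_diff a0 a1 a2)
  also have "exp (- m) * (m * (m * exp m + exp m) - 2 * m * (m * exp m) + m\<^sup>2 * exp m) = m"
    by (simp add: exp_minus field_simps power2_eq_square)
  also have "(\<lambda>n. exp (- m) * (real n * (real n * a n) - 2 * m * (real n * a n) + m\<^sup>2 * a n)) =
      (\<lambda>n. (real n - m)\<^sup>2 * (m ^ n / fact n * exp (- m)))"
    unfolding a_def[symmetric] by (simp add: fun_eq_iff power2_eq_square algebra_simps)
  finally show ?thesis .
qed

lemma poisson_process_card_measurable:
  assumes "poisson_process M Z u"
  shows "(\<lambda>\<omega>. card (Z \<omega>)) \<in> M \<rightarrow>\<^sub>M count_space UNIV"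
  using poisson_process_count_measurable[OF assms, of UNIV] by simp

text \<open>Chebyshev's inequality carried out on the series: the deviation event is split by the
  value of the count, and each probability is compared with the corresponding term of the variance
  series, whose sum is \<open>m\<close>.\<close>

lemma poisson_process_chebyshev:
  assumes pp: "poisson_process M Z u" and A: "A \<in> sets borel" and t: "t > 0"
  defines "m \<equiv> (LINT x:A|lborel. u x)"
  shows "measure M {\<omega>\<in>space M. t \<le> \<bar>real (card (Z \<omega> \<inter> A)) - m\<bar>} \<le> m / t\<^sup>2"
proof -
  interpret prob_space M by (rule poisson_process_prob_space[OF pp])
  note [measurable] = poisson_process_count_measurable[OF pp A]
  let ?J = "{n. t \<le> \<bar>real n - m\<bar>}"
  let ?E = "\<lambda>n. {\<omega>\<in>space M. card (Z \<omega> \<inter> A) = n}"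
  define p where "p n = measure M (?E n)" for n
  have p: "p n = m ^ n / fact n * exp (- m)" for n
    by (simp add: p_def m_def poisson_process_prob[OF pp A])
  \<comment> \<open>Intersecting with a set that is either everything or empty turns the union over
    \<open>?J\<close> into a union over all \<open>n\<close>, as countable additivity for sequences
    requires.\<close>
  have "(\<lambda>n. measure M (?E n \<inter> {\<omega>. n \<in> ?J})) sums measure M (\<Union>n. ?E n \<inter> {\<omega>. n \<in> ?J})"
    by (rule finite_measure_UNION) (auto simp: disjoint_family_on_def)
  also have "(\<Union>n. ?E n \<inter> {\<omega>. n \<in> ?J}) = {\<omega>\<in>space M. t \<le> \<bar>real (card (Z \<omega> \<inter> A)) - m\<bar>}"
    by (auto split: if_splits)
  also have "(\<lambda>n. measure M (?E n \<inter> {\<omega>. n \<in> ?J})) = (\<lambda>n. if n \<in> ?J then p n else 0)"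
    by (auto simp: fun_eq_iff p_def)
  finally have 1: "(\<lambda>n. if n \<in> ?J then p n else 0) sums
    measure M {\<omega>\<in>space M. t \<le> \<bar>real (card (Z \<omega> \<inter> A)) - m\<bar>}" .
  have "(\<lambda>n. (real n - m)\<^sup>2 * p n / t\<^sup>2) sums (m / t\<^sup>2)"
    unfolding p by (intro sums_divide poisson_variance_sums)
  with 1 show ?thesis
  proof (rule sums_le[rotated])
    fix n
    have "0 \<le> p n" by (simp add: p_def)
    moreover have "1 \<le> (real n - m)\<^sup>2 / t\<^sup>2" if "n \<in> ?J"
      using that t power_mono[of t "\<bar>real n - m\<bar>" 2] by simp
    ultimately show "(if n \<in> ?J then p n else 0) \<le> (real n - m)\<^sup>2 * p n / t\<^sup>2"
      using mult_right_mono[of 1 "(real n - m)\<^sup>2 / t\<^sup>2" "p n"] by auto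
  qed
qed

lemma poisson_count_tendsto:
  assumes pp: "\<forall>\<^sub>F N in sequentially. poisson_process (M N) (Z N) (u N)" and A: "A \<in> sets borel"
    and lim: "(\<lambda>N. (LINT x:A|lborel. u N x) / real N) \<longlonglongrightarrow> l"
  shows "((\<lambda>(N, \<omega>). real (card (Z N \<omega> \<inter> A)) / real N) \<longlongrightarrow> l) (in_prob M)"
proof -
  define L where "L N = (LINT x:A|lborel. u N x)" for N
  have "((\<lambda>(N, \<omega>). real (card (Z N \<omega> \<inter> A)) / real N - L N / real N) \<longlongrightarrow> 0) (in_prob M)"
  proof (rule tendstoI)
    fix e :: real assume e: "e > 0"
    let ?B = "\<lambda>N. {\<omega>\<in>space (M N). e * real N \<le> \<bar>real (card (Z N \<omega> \<inter> A)) - L N\<bar>}"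
    \<comment> \<open>The Chebyshev bound at \<open>t = e * N\<close>, factored so that the mean per
      \<open>N\<close> converges and a factor \<open>1 / N\<close> remains.\<close>
    have "(\<lambda>N. (L N / real N) * (1 / e\<^sup>2) * (1 / real N)) \<longlonglongrightarrow> l * (1 / e\<^sup>2) * 0"
      unfolding L_def by (intro tendsto_mult tendsto_const lim lim_1_over_n)
    then have r: "(\<lambda>N. L N / (e * real N)\<^sup>2) \<longlonglongrightarrow> 0"
      by (simp add: power2_eq_square field_simps)
    have "\<forall>\<^sub>F N in sequentially. ?B N \<in> sets (M N) \<and> measure (M N) (?B N) \<le> L N / (e * real N)\<^sup>2 \<and>
      (\<forall>\<omega>\<in>space (M N) - ?B N.
         dist (case (N, \<omega>) of (N, \<omega>) \<Rightarrow> real (card (Z N \<omega> \<inter> A)) / real N - L N / real N) 0 < e)"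
      using pp eventually_gt_at_top[of 0]
    proof eventually_elim
      case (elim N)
      note [measurable] = poisson_process_count_measurable[OF elim(1) A]
      have "?B N \<in> sets (M N)" by measurable
      moreover have "measure (M N) (?B N) \<le> L N / (e * real N)\<^sup>2"
        unfolding L_def using elim e by (intro poisson_process_chebyshev A) auto
      moreover have "dist (real (card (Z N \<omega> \<inter> A)) / real N - L N / real N) 0 < e"
        if "\<omega> \<in> space (M N) - ?B N" for \<omega>
        using that elim(2) by (auto simp: dist_real_def not_le pos_divide_less_eq simp flip: diff_divide_distrib)
      ultimately show ?case by simp
    qed
    then show "\<forall>\<^sub>F x in in_prob M.
        dist (case x of (N, \<omega>) \<Rightarrow> real (card (Z N \<omega> \<inter> A)) / real N - L N / real N) 0 < e"
      by (rule eventually_in_probI[OF _ r])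
  qed
  from tendsto_add[OF this tendsto_fst_in_prob[OF lim]] show ?thesis
    by (simp add: case_prod_unfold L_def)
qed

text \<open>Dominated convergence for indicators. Unlike continuity from above, it asks for no
  monotonicity of the sets.\<close>

lemma (in finite_measure) measure_tendsto_0:
  assumes [measurable]: "\<And>m. A m \<in> sets M" and "AE x in M. \<forall>\<^sub>F m in sequentially. x \<notin> A m"
  shows "(\<lambda>m. measure M (A m)) \<longlonglongrightarrow> 0"
proof -
  have "(\<lambda>m. \<integral>x. indicator (A m) x \<partial>M) \<longlonglongrightarrow> (\<integral>x. 0 \<partial>M :: real)"
  proof (rule integral_dominated_convergence)
    show "AE x in M. (\<lambda>m. indicator (A m) x :: real) \<longlonglongrightarrow> 0"
      using assms(2)
    proof eventually_elim
      case (elim x)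
      then have "\<forall>\<^sub>F m in sequentially. indicator (A m) x = (0::real)"
        by eventually_elim simp
      then show ?case by (rule tendsto_eventually)
    qed
    show "integrable M (\<lambda>x. 1 :: real)" by simp
  qed (auto simp: indicator_def)
  then show ?thesis by simp
qed

section \<open>The intensity measure and the probability of hitting a set\<close>

lemma
  assumes u: "integrable lborel u" "\<And>x. 0 \<le> u x"
  shows finite_measure_density_lborel: "finite_measure (density lborel u)"
    and measure_density_lborel:
      "A \<in> sets borel \<Longrightarrow> measure (density lborel u) A = (LINT x:A|lborel. u x)"
proof -
  have [measurable]: "u \<in> borel_measurable borel"
    using borel_measurable_integrable[OF u(1)] by simp
  show "finite_measure (density lborel u)"
    using u by (intro finite_measureI) (simp add: emeasure_density nn_integral_eq_integral)
  assume [measurable]: "A \<in> sets borel"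
  have "integrable lborel (\<lambda>x. u x * indicator A x)"
    using integrable_real_mult_indicator[of A lborel u] u by (simp add: mult.commute)
  then have "emeasure (density lborel u) A = ennreal (\<integral>x. u x * indicator A x \<partial>lborel)"
    using u by (subst nn_integral_eq_integral[symmetric])
      (auto simp: emeasure_density ennreal_mult' ennreal_indicator)
  then show "measure (density lborel u) A = (LINT x:A|lborel. u x)"
    using u by (simp add: measure_def set_lebesgue_integral_def mult.commute)
qed

lemmas poisson_process_finite_intensity =
  finite_measure_density_lborel[OF poisson_process_integrable poisson_process_nonneg]

lemmas poisson_process_intensity_measure =
  measure_density_lborel[OF poisson_process_integrable poisson_process_nonneg]

text \<open>The probability of a hit is \<open>1 - exp (- l)\<close> for \<open>l\<close> the
  intensity of \<open>A\<close>, and this is at most \<open>l\<close>.\<close>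

lemma poisson_process_hit:
  assumes pp: "poisson_process M Z u" and A: "A \<in> sets borel"
  shows "measure M {\<omega>\<in>space M. card (Z \<omega> \<inter> A) \<noteq> 0} \<le> measure (density lborel u) A"
proof -
  interpret prob_space M by (rule poisson_process_prob_space[OF pp])
  have [measurable]: "(\<lambda>\<omega>. card (Z \<omega> \<inter> A)) \<in> M \<rightarrow>\<^sub>M count_space UNIV"
    by (rule poisson_process_count_measurable[OF pp A])
  let ?l = "LINT x:A|lborel. u x"
  have "measure M {\<omega>\<in>space M. card (Z \<omega> \<inter> A) = 0} = ?l ^ 0 / fact 0 * exp (- ?l)"
    by (rule poisson_process_prob[OF pp A])
  then have "measure M {\<omega>\<in>space M. card (Z \<omega> \<inter> A) = 0} = exp (- ?l)" by simp
  then have "measure M {\<omega>\<in>space M. card (Z \<omega> \<inter> A) \<noteq> 0} = 1 - exp (- ?l)"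
    using prob_neg[of "\<lambda>\<omega>. card (Z \<omega> \<inter> A) = 0"] by simp
  then show ?thesis
    using exp_ge_add_one_self[of "- ?l"] by (simp add: poisson_process_intensity_measure[OF pp pp A])
qed

lemma poisson_process_null_set:
  assumes pp: "poisson_process M Z u" and A: "A \<in> sets borel" and 0: "(LINT x:A|lborel. u x) = 0"
  shows "AE \<omega> in M. Z \<omega> \<inter> A = {}"
proof -
  interpret prob_space M by (rule poisson_process_prob_space[OF pp])
  have [measurable]: "(\<lambda>\<omega>. card (Z \<omega> \<inter> A)) \<in> M \<rightarrow>\<^sub>M count_space UNIV"
    by (rule poisson_process_count_measurable[OF pp A])
  have "measure M {\<omega>\<in>space M. card (Z \<omega> \<inter> A) \<noteq> 0} = 0"
    using poisson_process_hit[OF pp A] poisson_process_intensity_measure[OF pp pp A] 0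
    by (simp add: measure_le_0_iff)
  then have "AE \<omega> in M. \<not> card (Z \<omega> \<inter> A) \<noteq> 0"
    by (subst (asm) prob_Collect_eq_0) auto
  then show ?thesis
    using AE_space
  proof eventually_elim
    case (elim \<omega>)
    then show ?case using poisson_process_finite[OF pp] by auto
  qed
qed

subsection \<open>Absence of ties\<close>

lemma poisson_process_hit3:
  assumes pp: "poisson_process M Z u"
    and A: "A \<in> sets borel" "B \<in> sets borel" "C \<in> sets borel"
    and disj: "A \<inter> B = {}" "A \<inter> C = {}" "B \<inter> C = {}"
  defines "n \<equiv> density lborel u"
  shows "measure M {\<omega>\<in>space M. card (Z \<omega> \<inter> A) \<noteq> 0 \<and> card (Z \<omega> \<inter> B) \<noteq> 0 \<and> card (Z \<omega> \<inter> C) \<noteq> 0}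
    \<le> measure n A * (measure n B * measure n C)"
proof -
  interpret prob_space M by (rule poisson_process_prob_space[OF pp])
  \<comment> \<open>Independence is available for families indexed by natural numbers, so the three
    sets are numbered.\<close>
  define S where "S i = (if i = 0 then A else if i = 1 then B else C)" for i :: nat
  have S: "\<forall>i\<in>{0,1,2}. S i \<in> sets borel" "disjoint_family_on S {0,1,2}"
    using A disj by (auto simp: S_def disjoint_family_on_def)
  have "indep_vars (\<lambda>_. count_space UNIV) (\<lambda>i \<omega>. card (Z \<omega> \<inter> S i)) {0,1,2}"
    by (rule poisson_process_indep[OF pp _ S]) simp
  from indep_varsD[OF this, of "{0,1,2}" "\<lambda>_. {0<..}"]
  have "measure M (\<Inter>i\<in>{0,1,2}. (\<lambda>\<omega>. card (Z \<omega> \<inter> S i)) -` {0<..} \<inter> space M) =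
    (\<Prod>i\<in>{0,1,2}. measure M ((\<lambda>\<omega>. card (Z \<omega> \<inter> S i)) -` {0<..} \<inter> space M))" by simp
  also have "(\<Inter>i\<in>{0,1,2}. (\<lambda>\<omega>. card (Z \<omega> \<inter> S i)) -` {0<..} \<inter> space M) =
     {\<omega>\<in>space M. card (Z \<omega> \<inter> A) \<noteq> 0 \<and> card (Z \<omega> \<inter> B) \<noteq> 0 \<and> card (Z \<omega> \<inter> C) \<noteq> 0}"
    by (auto simp: S_def)
  also have "(\<Prod>i\<in>{0,1,2}. measure M ((\<lambda>\<omega>. card (Z \<omega> \<inter> S i)) -` {0<..} \<inter> space M)) \<le>
     (\<Prod>i\<in>{0,1,2}. measure n (S i))"
  proof (rule prod_mono, intro conjI)
    fix i :: nat assume "i \<in> {0,1,2}"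
    moreover have "(\<lambda>\<omega>. card (Z \<omega> \<inter> S i)) -` {0<..} \<inter> space M = {\<omega>\<in>space M. card (Z \<omega> \<inter> S i) \<noteq> 0}"
      by auto
    ultimately show "measure M ((\<lambda>\<omega>. card (Z \<omega> \<inter> S i)) -` {0<..} \<inter> space M) \<le> measure n (S i)"
      using poisson_process_hit[OF pp, of "S i"] S unfolding n_def by auto
  qed simp
  also have "\<dots> = measure n A * (measure n B * measure n C)"
    by (simp add: S_def)
  finally show ?thesis .
qed

text \<open>
  Mecke's formula is avoided: a refining sequence of finite partitions eventually separates the
  points, and by independence the probability that three distinct cells whose product meets \<open>R\<close>
  all contain points is at most the triple product measure of the union of these products, which
  shrinks to \<open>R\<close> because \<open>R\<close> is closed.
\<close>
lemma poisson_process_avoids_null_triples: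
  fixes R :: "('a::euclidean_space \<times> 'a \<times> 'a) set"
  assumes pp: "poisson_process M Z u" and R: "closed R"
    and null: "\<And>a b. emeasure lborel {c. (a, b, c) \<in> R} = 0"
  shows "AE \<omega> in M. \<forall>x\<in>Z \<omega>. \<forall>y\<in>Z \<omega>. \<forall>z\<in>Z \<omega>. x \<noteq> y \<and> x \<noteq> z \<and> y \<noteq> z \<longrightarrow> (x, y, z) \<notin> R"
proof -
  interpret prob_space M by (rule poisson_process_prob_space[OF pp])
  define n where "n = density lborel u"
  interpret n: finite_measure n
    unfolding n_def by (rule poisson_process_finite_intensity[OF pp pp])
  have sets_n [measurable_cong, simp]: "sets n = sets borel" by (simp add: n_def)
  interpret n2: finite_measure "n \<Otimes>\<^sub>M n" by (intro finite_measure_pair_measure n.finite_measure_axioms)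
  interpret n3: finite_measure "n \<Otimes>\<^sub>M (n \<Otimes>\<^sub>M n)"
    by (intro finite_measure_pair_measure n.finite_measure_axioms n2.finite_measure_axioms)
  have sets3: "sets (n \<Otimes>\<^sub>M (n \<Otimes>\<^sub>M n)) = sets borel"
  proof -
    have "sets (n \<Otimes>\<^sub>M (n \<Otimes>\<^sub>M n)) = sets (borel \<Otimes>\<^sub>M (borel \<Otimes>\<^sub>M borel))"
      by (intro sets_pair_measure_cong sets_n)
    then show ?thesis by (simp only: borel_prod)
  qed
  have [measurable]: "u \<in> borel_measurable borel" 
    using borel_measurable_integrable[OF poisson_process_integrable[OF pp]] by simp

  obtain BB :: "'a set set" where BB: "countable BB" "topological_basis BB"
    using ex_countable_basis by blast
  have "BB \<noteq> {}" using BB(2) topological_basisE[of BB UNIV "undefined"] by fastforce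
  define b where "b = from_nat_into BB"
  have b_range: "range b = BB" unfolding b_def by (rule range_from_nat_into[OF \<open>BB \<noteq> {}\<close> BB(1)])
  have b_basis: "\<exists>i. x \<in> b i \<and> b i \<subseteq> U" if "open U" "x \<in> U" for x U
    using topological_basisE[OF BB(2) that] b_range by (metis rangeE)
  have [measurable]: "b i \<in> sets borel" for i
    using topological_basis_open[OF BB(2)] b_range by auto
  \<comment> \<open>\<open>\<kappa> m x\<close> records which of the first \<open>m\<close> basic
    sets contain \<open>x\<close>; the cells are the classes of points with equal record. They
    refine as \<open>m\<close> grows, and since the \<open>b i\<close> form a basis, distinct points
    are eventually separated and each cell eventually lies in any given neighborhood of its
    point.\<close>
  define \<kappa> where "\<kappa> m x = {i. i < m \<and> x \<in> b i}" for m :: nat and x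
  have \<kappa>_eq: "x \<in> b i \<longleftrightarrow> y \<in> b i" if "\<kappa> m x = \<kappa> m y" "i < m" for x y i m
    using that by (auto simp: \<kappa>_def)
  define cell where "cell m s = {x. \<kappa> m x = s}" for m s
  have cell_alt: "cell m s = {x. s \<subseteq> {..<m} \<and> (\<forall>i\<in>{..<m}. x \<in> b i \<longleftrightarrow> i \<in> s)}" for m s
    by (auto simp: cell_def \<kappa>_def)
  have cell_sets [measurable]: "cell m s \<in> sets borel" for m s
  proof -
    have "{x \<in> space borel. s \<subseteq> {..<m} \<and> (\<forall>i\<in>{..<m}. x \<in> b i \<longleftrightarrow> i \<in> s)} \<in> sets borel" by measurable
    then show ?thesis by (simp add: cell_alt)
  qed
  have [measurable]: "(\<lambda>\<omega>. card (Z \<omega> \<inter> A)) \<in> M \<rightarrow>\<^sub>M count_space UNIV" if "A \<in> sets borel" for A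
    by (rule poisson_process_count_measurable[OF pp that])

  \<comment> \<open>The event that level \<open>m\<close> fails to separate the points. For each
    outcome this ends at a finite level, because \<open>Z \<omega>\<close> is finite.\<close>
  define D where "D m = {\<omega>\<in>space M. \<exists>s\<in>Pow {..<m}. 2 \<le> card (Z \<omega> \<inter> cell m s)}" for m
  have D_sets [measurable]: "D m \<in> sets M" for m
    unfolding D_def by measurable
  have "(\<lambda>m. measure M (D m)) \<longlonglongrightarrow> 0"
  proof (rule measure_tendsto_0[OF D_sets AE_I2])
    fix \<omega> assume "\<omega> \<in> space M"
    then have fin: "finite (Z \<omega>)" by (rule poisson_process_finite[OF pp])
    have sep: "\<forall>\<^sub>F m in sequentially. \<kappa> m (fst p) \<noteq> \<kappa> m (snd p)"
      if "p \<in> {p\<in>Z \<omega> \<times> Z \<omega>. fst p \<noteq> snd p}" for p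
    proof -
      have "\<exists>i. fst p \<in> b i \<and> b i \<subseteq> - {snd p}" using that by (intro b_basis) auto
      then obtain i where "fst p \<in> b i" "snd p \<notin> b i" by auto
      then show ?thesis by (intro eventually_mono[OF eventually_gt_at_top[of i]]) (use \<kappa>_eq in blast)
    qed
    have "\<forall>\<^sub>F m in sequentially. \<forall>p\<in>{p\<in>Z \<omega> \<times> Z \<omega>. fst p \<noteq> snd p}. \<kappa> m (fst p) \<noteq> \<kappa> m (snd p)"
      by (rule eventually_ball_finite) (use fin sep in auto)
    then show "\<forall>\<^sub>F m in sequentially. \<omega> \<notin> D m"
    proof eventually_elim
      case (elim m)
      have le1: "card (Z \<omega> \<inter> cell m s) \<le> 1" for s
        using elim by (intro card_le_Suc0_iff_eq[THEN iffD2, simplified One_nat_def[symmetric]])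
          (use fin in \<open>auto simp: cell_def\<close>)
      show ?case
      proof
        assume "\<omega> \<in> D m"
        then obtain s where "2 \<le> card (Z \<omega> \<inter> cell m s)" by (auto simp: D_def)
        then show False using le1[of s] by linarith
      qed
    qed
  qed
  moreover
  \<comment> \<open>\<open>J m\<close> indexes the products of three cells that meet
    \<open>R\<close>; their union \<open>Rm m\<close> is an outer approximation of \<open>R\<close>.
    Only triples of pairwise different cells, those in \<open>J' m\<close>, have independent
    counts.\<close>
  define J where "J m = (\<lambda>(x, y, z). (\<kappa> m x, \<kappa> m y, \<kappa> m z)) ` R" for m
  define prd where "prd m = (\<lambda>(s, t, r). cell m s \<times> cell m t \<times> cell m r)" for m
  define J' where "J' m = {(s, t, r). (s, t, r) \<in> J m \<and> s \<noteq> t \<and> s \<noteq> r \<and> t \<noteq> r}" for m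
  have J_fin: "finite (J m)" for m
    by (rule finite_subset[of _ "Pow {..<m} \<times> Pow {..<m} \<times> Pow {..<m}"]) (auto simp: J_def \<kappa>_def)
  have J'_fin: "finite (J' m)" for m
    by (rule finite_subset[OF _ J_fin[of m]]) (auto simp: J'_def)
  define Rm where "Rm m = (\<Union>j\<in>J m. prd m j)" for m
  have prd_sets: "prd m j \<in> sets (n \<Otimes>\<^sub>M (n \<Otimes>\<^sub>M n))" for m j
    unfolding prd_def by (auto split: prod.split intro!: pair_measureI)
  have Rm_sets: "Rm m \<in> sets (n \<Otimes>\<^sub>M (n \<Otimes>\<^sub>M n))" for m
    unfolding Rm_def using J_fin prd_sets by (intro sets.finite_UN) auto
  have Rm_meas: "measure (n \<Otimes>\<^sub>M (n \<Otimes>\<^sub>M n)) (Rm m) =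
      (\<Sum>(s, t, r)\<in>J m. measure n (cell m s) * (measure n (cell m t) * measure n (cell m r)))" for m
  proof -
    have "measure (n \<Otimes>\<^sub>M (n \<Otimes>\<^sub>M n)) (Rm m) = (\<Sum>j\<in>J m. measure (n \<Otimes>\<^sub>M (n \<Otimes>\<^sub>M n)) (prd m j))"
      unfolding Rm_def using J_fin prd_sets
      by (intro n3.finite_measure_finite_Union)
        (auto simp: disjoint_family_on_def prd_def cell_def split: prod.splits)
    also have "\<dots> = (\<Sum>(s, t, r)\<in>J m. measure n (cell m s) * (measure n (cell m t) * measure n (cell m r)))"
      by (intro sum.cong refl) (auto simp: prd_def measure_def
          n.emeasure_pair_measure_Times n2.emeasure_pair_measure_Times enn2real_mult)
    finally show ?thesis .
  qed
  have "(\<lambda>m. measure (n \<Otimes>\<^sub>M (n \<Otimes>\<^sub>M n)) (Rm m)) \<longlonglongrightarrow> 0"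
  proof (rule n3.measure_tendsto_0[OF Rm_sets])
    have Rs: "R \<in> sets (n \<Otimes>\<^sub>M (n \<Otimes>\<^sub>M n))" unfolding sets3 by (rule borel_closed[OF R])
    \<comment> \<open>Tonelli: each slice of \<open>R\<close> in the last coordinate is Lebesgue
      null, hence null for the intensity measure.\<close>
    have "emeasure (n \<Otimes>\<^sub>M (n \<Otimes>\<^sub>M n)) R = (\<integral>\<^sup>+x. emeasure (n \<Otimes>\<^sub>M n) (Pair x -` R) \<partial>n)"
      by (rule n2.emeasure_pair_measure_alt[OF Rs])
    also have "\<dots> = (\<integral>\<^sup>+x. (\<integral>\<^sup>+y. emeasure n (Pair y -` (Pair x -` R)) \<partial>n) \<partial>n)"
      by (intro nn_integral_cong n.emeasure_pair_measure_alt sets_Pair1[OF Rs])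
    also have "\<dots> = (\<integral>\<^sup>+x. (\<integral>\<^sup>+y. 0 \<partial>n) \<partial>n)"
    proof (intro nn_integral_cong)
      fix x y
      have "Pair y -` (Pair x -` R) \<in> sets borel"
        using sets_Pair1[OF sets_Pair1[OF Rs, of x], of y] by simp
      moreover have "Pair y -` (Pair x -` R) = {c. (x, y, c) \<in> R}" by auto
      ultimately have "Pair y -` (Pair x -` R) \<in> null_sets lborel"
        using null[of x y] by auto
      then have "Pair y -` (Pair x -` R) \<in> null_sets n"
        unfolding n_def by (intro absolutely_continuousI_density[unfolded absolutely_continuous_def, THEN subsetD]) auto
      then show "emeasure n (Pair y -` (Pair x -` R)) = 0" by auto
    qed
    finally have "R \<in> null_sets (n \<Otimes>\<^sub>M (n \<Otimes>\<^sub>M n))" using Rs by auto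
    then have "AE p in n \<Otimes>\<^sub>M (n \<Otimes>\<^sub>M n). p \<notin> R" by (rule AE_not_in)
    then show "AE p in n \<Otimes>\<^sub>M (n \<Otimes>\<^sub>M n). \<forall>\<^sub>F m in sequentially. p \<notin> Rm m"
    proof eventually_elim
      case (elim p)
      obtain x y z where p: "p = (x, y, z)" by (cases p)
      \<comment> \<open>Closedness of \<open>R\<close> enters here: a point outside \<open>R\<close>
        has a box around it that avoids \<open>R\<close>, and at a fine enough level its product
        cell lies in that box.\<close>
      have "open (- R)" using R by (rule open_Compl)
      then obtain U V where UV: "open U" "open V" "x \<in> U" "(y, z) \<in> V" "U \<times> V \<subseteq> - R"
        using elim p by (metis ComplI open_prod_elim mem_Times_iff fst_conv snd_conv)
      obtain V1 V2 where V: "open V1" "open V2" "y \<in> V1" "z \<in> V2" "V1 \<times> V2 \<subseteq> V"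
        using UV by (metis open_prod_elim mem_Times_iff fst_conv snd_conv)
      obtain i1 i2 i3 where i: "x \<in> b i1" "b i1 \<subseteq> U" "y \<in> b i2" "b i2 \<subseteq> V1" "z \<in> b i3" "b i3 \<subseteq> V2"
        using b_basis UV V by meson
      show ?case
        using eventually_gt_at_top[of "max i1 (max i2 i3)"]
      proof eventually_elim
        case (elim m)
        show ?case
        proof
          assume "p \<in> Rm m"
          then obtain x' y' z' where *: "(x', y', z') \<in> R" "\<kappa> m x = \<kappa> m x'" "\<kappa> m y = \<kappa> m y'" "\<kappa> m z = \<kappa> m z'"
            by (auto simp: Rm_def J_def prd_def cell_def p)
          then have "x' \<in> b i1" "y' \<in> b i2" "z' \<in> b i3"
            using elim i \<kappa>_eq by (metis max_less_iff_conj)+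
          then show False using i UV(5) V(5) *(1) by blast
        qed
      qed
    qed
  qed
  ultimately have lim: "(\<lambda>m. measure M (D m) + measure (n \<Otimes>\<^sub>M (n \<Otimes>\<^sub>M n)) (Rm m)) \<longlonglongrightarrow> 0"
    by (rule tendsto_add_zero)
  define H where "H m = (\<lambda>(s, t, r). {\<omega>\<in>space M. card (Z \<omega> \<inter> cell m s) \<noteq> 0 \<and>
    card (Z \<omega> \<inter> cell m t) \<noteq> 0 \<and> card (Z \<omega> \<inter> cell m r) \<noteq> 0})" for m
  have H_sets: "H m j \<in> sets M" for m j
    unfolding H_def by (cases j) auto
  define G where "G m = (\<Union>j\<in>J' m. H m j)" for m
  have G_sets [measurable]: "G m \<in> sets M" for m
    unfolding G_def using J'_fin H_sets by (intro sets.finite_UN) auto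
  have G: "measure M (G m) \<le> measure (n \<Otimes>\<^sub>M (n \<Otimes>\<^sub>M n)) (Rm m)" for m
  proof -
    have "measure M (G m) \<le> (\<Sum>j\<in>J' m. measure M (H m j))"
      unfolding G_def using J'_fin H_sets by (intro finite_measure_subadditive_finite) auto
    also have "\<dots> \<le> (\<Sum>(s, t, r)\<in>J' m. measure n (cell m s) * (measure n (cell m t) * measure n (cell m r)))"
    proof (intro sum_mono)
      fix j assume "j \<in> J' m"
      then obtain s t r where j: "j = (s, t, r)" and "s \<noteq> t" "s \<noteq> r" "t \<noteq> r"
        by (auto simp: J'_def)
      then have "cell m s \<inter> cell m t = {}" "cell m s \<inter> cell m r = {}" "cell m t \<inter> cell m r = {}"
        by (auto simp: cell_def)
      from poisson_process_hit3[OF pp cell_sets cell_sets cell_sets this] show "measure M (H m j) \<le>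
        (case j of (s, t, r) \<Rightarrow> measure n (cell m s) * (measure n (cell m t) * measure n (cell m r)))"
        by (simp add: H_def n_def j)
    qed
    also have "\<dots> \<le> (\<Sum>(s, t, r)\<in>J m. measure n (cell m s) * (measure n (cell m t) * measure n (cell m r)))"
      by (intro sum_mono2 J_fin) (auto simp: J'_def)
    finally show ?thesis by (simp add: Rm_meas)
  qed
  show ?thesis
  proof (rule AE_I)
    \<comment> \<open>A bad outcome lies in \<open>D m\<close> or \<open>G m\<close> at every level:
      either two of the three points share a cell, or their three different cells are all hit and
      form a triple in \<open>J' m\<close>.\<close>
    let ?N = "\<Inter>m. D m \<union> G m"
    show "{\<omega>\<in>space M. \<not> (\<forall>x\<in>Z \<omega>. \<forall>y\<in>Z \<omega>. \<forall>z\<in>Z \<omega>. x \<noteq> y \<and> x \<noteq> z \<and> y \<noteq> z \<longrightarrow> (x, y, z) \<notin> R)} \<subseteq> ?N"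
    proof (intro subsetI INT_I)
      fix \<omega> m
      assume "\<omega> \<in> {\<omega>\<in>space M. \<not> (\<forall>x\<in>Z \<omega>. \<forall>y\<in>Z \<omega>. \<forall>z\<in>Z \<omega>. x \<noteq> y \<and> x \<noteq> z \<and> y \<noteq> z \<longrightarrow> (x, y, z) \<notin> R)}"
      then obtain x y z where \<omega>: "\<omega> \<in> space M" and xyz: "x \<in> Z \<omega>" "y \<in> Z \<omega>" "z \<in> Z \<omega>"
        "x \<noteq> y" "x \<noteq> z" "y \<noteq> z" "(x, y, z) \<in> R" by blast
      have fin: "finite (Z \<omega>)" by (rule poisson_process_finite[OF pp \<omega>])
      have ne: "card (Z \<omega> \<inter> cell m (\<kappa> m v)) \<noteq> 0" if "v \<in> Z \<omega>" for v
        using fin that by (auto simp: cell_def)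
      have two: "\<omega> \<in> D m" if "v \<in> Z \<omega>" "w \<in> Z \<omega>" "v \<noteq> w" "\<kappa> m v = \<kappa> m w" for v w
      proof -
        have "card {v, w} \<le> card (Z \<omega> \<inter> cell m (\<kappa> m v))"
          using fin that by (intro card_mono) (auto simp: cell_def)
        moreover have "\<kappa> m v \<in> Pow {..<m}" by (auto simp: \<kappa>_def)
        moreover have "card {v, w} = 2" using that(3) by simp
        ultimately have "\<exists>s\<in>Pow {..<m}. 2 \<le> card (Z \<omega> \<inter> cell m s)" by metis
        then show ?thesis using \<omega> by (simp add: D_def)
      qed
      show "\<omega> \<in> D m \<union> G m"
      proof (cases "\<kappa> m x = \<kappa> m y \<or> \<kappa> m x = \<kappa> m z \<or> \<kappa> m y = \<kappa> m z")
        case True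
        then show ?thesis using two xyz by auto
      next
        case False
        then have "(\<kappa> m x, \<kappa> m y, \<kappa> m z) \<in> J' m"
          using xyz(7) by (auto simp: J'_def J_def intro!: image_eqI[of _ _ "(x, y, z)"])
        moreover have "\<omega> \<in> H m (\<kappa> m x, \<kappa> m y, \<kappa> m z)"
          using ne xyz \<omega> by (simp add: H_def)
        ultimately show ?thesis unfolding G_def by blast
      qed
    qed
    show "?N \<in> sets M" by measurable
    have "measure M ?N \<le> measure M (D m) + measure (n \<Otimes>\<^sub>M (n \<Otimes>\<^sub>M n)) (Rm m)" for m
    proof -
      have "measure M ?N \<le> measure M (D m \<union> G m)"
        by (rule finite_measure_mono) auto
      also have "\<dots> \<le> measure M (D m) + measure M (G m)"
        by (rule measure_Un_le) auto
      finally show ?thesis using G[of m] by linarith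
    qed
    then have "measure M ?N \<le> 0"
      using lim by (intro LIMSEQ_le_const) auto
    then show "emeasure M ?N = 0"
      by (simp add: emeasure_eq_measure measure_le_0_iff)
  qed
qed

lemma emeasure_lborel_sphere: "emeasure lborel (sphere (a :: 'a::euclidean_space) r) = 0"
proof -
  have "sphere a r \<in> null_sets lebesgue"
    using negligible_sphere[of a r] by (simp add: negligible_iff_null_sets)
  then show ?thesis
    by (subst (asm) null_sets_completion_iff) auto
qed

text \<open>For fixed \<open>a\<close> and \<open>b\<close>, the points \<open>c\<close> as far from
  \<open>a\<close> as \<open>b\<close> form a sphere, which is a null set.\<close>

lemma poisson_process_tie_free:
  fixes Z :: "'w \<Rightarrow> 'a::euclidean_space set"
  assumes pp: "poisson_process M Z u"
  shows "AE \<omega> in M. tie_free (Z \<omega>)"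
proof -
  let ?R = "{(a, b, c). dist a b = dist a c} :: ('a \<times> 'a \<times> 'a) set"
  have "closed {p :: 'a \<times> 'a \<times> 'a. dist (fst p) (fst (snd p)) = dist (fst p) (snd (snd p))}"
    by (intro closed_Collect_eq continuous_intros)
  then have "closed ?R" by (simp add: case_prod_unfold)
  moreover have "emeasure lborel {c. (a, b, c) \<in> ?R} = 0" for a b
  proof -
    have "{c. (a, b, c) \<in> ?R} = sphere a (dist a b)" by auto
    then show ?thesis by (simp add: emeasure_lborel_sphere)
  qed
  ultimately have "AE \<omega> in M. \<forall>x\<in>Z \<omega>. \<forall>y\<in>Z \<omega>. \<forall>z\<in>Z \<omega>. x \<noteq> y \<and> x \<noteq> z \<and> y \<noteq> z \<longrightarrow> (x, y, z) \<notin> ?R"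
    by (rule poisson_process_avoids_null_triples[OF pp])
  then show ?thesis
  proof eventually_elim
    case (elim \<omega>)
    then show ?case by (fastforce simp: tie_free_def inj_on_def)
  qed
qed

subsection \<open>Concentration of the cross count given the points\<close>

lemma subset_mean_eq_sum_labels:
  fixes w :: "'i \<Rightarrow> nat \<Rightarrow> real"
  assumes "finite I" "\<And>i. i \<in> I \<Longrightarrow> w i 1 + w i 2 = 1"
  shows "(\<Sum>S\<in>Pow I. (\<Prod>i\<in>I. w i (if i \<in> S then 1 else 2)) * F S) = subset_mean (\<lambda>i. w i 1) I F"
  unfolding subset_mean_def
proof (intro sum.cong refl arg_cong2[where f = "(*)"])
  fix S assume S: "S \<in> Pow I"
  have "(\<Prod>i\<in>I. w i (if i \<in> S then 1 else 2)) =
      (\<Prod>i\<in>S. w i (if i \<in> S then 1 else 2)) * (\<Prod>i\<in>I - S. w i (if i \<in> S then 1 else 2))"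
    using S assms(1) by (subst prod.subset_diff[of S I]) (auto simp: mult.commute)
  also have "\<dots> = (\<Prod>i\<in>S. w i 1) * (\<Prod>i\<in>I - S. 1 - w i 1)"
    using assms(2) by (intro arg_cong2[where f = "(*)"] prod.cong) (auto simp: algebra_simps)
  finally show "(\<Prod>i\<in>I. w i (if i \<in> S then 1 else 2)) = (\<Prod>i\<in>S. w i 1) * (\<Prod>i\<in>I - S. 1 - w i 1)" .
qed

text \<open>One fixed \<open>N\<close>, with the enumeration \<open>X\<close> made explicit.
  \<open>\<pi>_sum\<close> is required only almost surely and on \<open>Z \<omega>\<close>, because
  label probabilities given by a quotient sum to 0 where the intensity vanishes.\<close>

locale labelled_process =
  fixes M :: "'w measure" and Z :: "'w \<Rightarrow> 'a::euclidean_space set" and u :: "'a \<Rightarrow> real"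
    and c :: "'w \<Rightarrow> 'a \<Rightarrow> nat" and \<pi> :: "'a \<Rightarrow> nat \<Rightarrow> real" and X :: "nat \<Rightarrow> 'w \<Rightarrow> 'a" and K :: nat
  assumes pp: "poisson_process M Z u"
    and X_meas: "\<And>i. X i \<in> points_algebra M Z \<rightarrow>\<^sub>M borel"
    and X_bij: "\<And>\<omega>. \<omega> \<in> space M \<Longrightarrow> bij_betw (\<lambda>i. X i \<omega>) {..<card (Z \<omega>)} (Z \<omega>)"
    and lab_meas: "\<And>i j. {\<omega>\<in>space M. i < card (Z \<omega>) \<and> c \<omega> (X i \<omega>) = j} \<in> sets M"
    and cond: "\<And>a :: nat \<Rightarrow> nat. AE \<omega> in M.
           real_cond_exp M (points_algebra M Z)
             (indicat_real {\<omega>\<in>space M. \<forall>i<card (Z \<omega>). c \<omega> (X i \<omega>) = a i}) \<omega> =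
           (\<Prod>i<card (Z \<omega>). \<pi> (X i \<omega>) (a i))"
    and \<pi>_meas [measurable]: "\<And>j. (\<lambda>z. \<pi> z j) \<in> borel_measurable borel"
    and \<pi>_01: "\<And>z j. 0 \<le> \<pi> z j" "\<And>z j. \<pi> z j \<le> 1"
    and \<pi>_sum: "AE \<omega> in M. \<forall>z\<in>Z \<omega>. \<pi> z 1 + \<pi> z 2 = 1"
begin

sublocale prob_space M by (rule poisson_process_prob_space[OF pp])

abbreviation "F \<equiv> points_algebra M Z"
abbreviation "n \<omega> \<equiv> card (Z \<omega>)"

lemma space_F [simp]: "space F = space M"
  by (simp add: points_algebra_def space_measure_of_conv)

lemma F_gen: "{{\<omega>\<in>space M. card (Z \<omega> \<inter> A) = n} |A n. A \<in> sets borel} \<subseteq> Pow (space M)"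
  by auto

lemma F_sub: "subalgebra M F"
proof -
  have "{{\<omega>\<in>space M. card (Z \<omega> \<inter> A) = n} |A n. A \<in> sets borel} \<subseteq> sets M"
  proof safe
    fix A :: "'a set" and n assume "A \<in> sets borel"
    then have [measurable]: "(\<lambda>\<omega>. card (Z \<omega> \<inter> A)) \<in> M \<rightarrow>\<^sub>M count_space UNIV"
      by (rule poisson_process_count_measurable[OF pp])
    show "{\<omega>\<in>space M. card (Z \<omega> \<inter> A) = n} \<in> sets M" by measurable
  qed
  then have "sets F \<subseteq> sets M"
    unfolding points_algebra_def by (subst sets_measure_of[OF F_gen]) (rule sets.sigma_sets_subset)
  then show ?thesis by (simp add: subalgebra_def)
qed

sublocale F: sigma_finite_subalgebra M F
proof -
  have "finite_measure_subalgebra M F"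
    by (intro finite_measure_subalgebra.intro finite_measure_subalgebra_axioms.intro
        finite_measure_axioms F_sub)
  then show "sigma_finite_subalgebra M F"
    by (rule finite_measure_subalgebra_is_sigma_finite)
qed

lemma from_F: "f \<in> measurable F N \<Longrightarrow> f \<in> measurable M N"
  by (rule measurable_from_subalg[OF F_sub])

lemma n_F [measurable]: "n \<in> F \<rightarrow>\<^sub>M count_space UNIV"
proof (rule measurable_count_space_eq2_countable[THEN iffD2], intro conjI ballI)
  fix m :: nat
  have "{\<omega>\<in>space M. card (Z \<omega> \<inter> UNIV) = m} \<in> sets F"
    unfolding points_algebra_def sets_measure_of[OF F_gen] by (rule sigma_sets.Basic, rule CollectI, rule exI[of _ UNIV], rule exI[of _ m], simp)
  then show "n -` {m} \<inter> space F \<in> sets F" by (simp add: vimage_def Int_def conj_commute)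
qed auto

lemma n_M [measurable]: "n \<in> M \<rightarrow>\<^sub>M count_space UNIV"
  by (rule from_F[OF n_F])

lemma X_F [measurable]: "X i \<in> F \<rightarrow>\<^sub>M borel"
  by (rule X_meas)

lemma X_M [measurable]: "X i \<in> M \<rightarrow>\<^sub>M borel"
  by (rule from_F[OF X_meas])

definition E :: "'w \<Rightarrow> (nat \<times> nat) set" where
  "E \<omega> = {(i, j). i < n \<omega> \<and> j < n \<omega> \<and> (X i \<omega>, X j \<omega>) \<in> knn_edges K (Z \<omega>)}"

text \<open>This expresses an edge between indices through \<open>n\<close> and the
  \<open>X l\<close> alone, by counting indices instead of points; hence the graph is measurable
  with respect to the points.\<close>

lemma E_iff:
  assumes \<omega>: "\<omega> \<in> space M" and ij: "i < n \<omega>" "j < n \<omega>"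
  shows "(i, j) \<in> E \<omega> \<longleftrightarrow> i \<noteq> j \<and>
    (\<Sum>l<n \<omega>. of_bool (l \<noteq> i \<and> dist (X i \<omega>) (X l \<omega>) < dist (X i \<omega>) (X j \<omega>))) < K"
proof -
  note bij = X_bij[OF \<omega>]
  have in_Z: "X l \<omega> \<in> Z \<omega>" if "l < n \<omega>" for l using bij that by (auto simp: bij_betw_def)
  have eq: "X l \<omega> = X l' \<omega> \<longleftrightarrow> l = l'" if "l < n \<omega>" "l' < n \<omega>" for l l'
    using bij that by (auto simp: bij_betw_def inj_on_def)
  let ?L = "{l\<in>{..<n \<omega>}. l \<noteq> i \<and> dist (X i \<omega>) (X l \<omega>) < dist (X i \<omega>) (X j \<omega>)}"
  have "{z \<in> Z \<omega> - {X i \<omega>}. dist (X i \<omega>) z < dist (X i \<omega>) (X j \<omega>)} = (\<lambda>l. X l \<omega>) ` ?L"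
    using bij eq ij by (auto simp: bij_betw_def)
  moreover have "inj_on (\<lambda>l. X l \<omega>) ?L"
    using bij by (auto simp: bij_betw_def inj_on_def)
  ultimately have "card {z \<in> Z \<omega> - {X i \<omega>}. dist (X i \<omega>) z < dist (X i \<omega>) (X j \<omega>)} = card ?L"
    by (simp add: card_image)
  also have "\<dots> = (\<Sum>l<n \<omega>. of_bool (l \<noteq> i \<and> dist (X i \<omega>) (X l \<omega>) < dist (X i \<omega>) (X j \<omega>)))"
    by (simp add: of_bool_def sum.If_cases Int_def conj_commute)
  finally show ?thesis
    using ij in_Z eq by (auto simp: E_def knn_edges_def)
qed

lemma E_F [measurable]: "Measurable.pred F (\<lambda>\<omega>. (i, j) \<in> E \<omega>)"
proof -
  \<comment> \<open>Naming the value of \<open>n \<omega>\<close> by a countable existential frees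
    the range of the sum from its dependence on \<open>\<omega>\<close>.\<close>
  have "{\<omega>\<in>space F. i < n \<omega> \<and> j < n \<omega> \<and> i \<noteq> j \<and> (\<exists>m. n \<omega> = m \<and>
    (\<Sum>l<m. of_bool (l \<noteq> i \<and> dist (X i \<omega>) (X l \<omega>) < dist (X i \<omega>) (X j \<omega>))) < K)} \<in> sets F"
    by measurable
  also have "{\<omega>\<in>space F. i < n \<omega> \<and> j < n \<omega> \<and> i \<noteq> j \<and> (\<exists>m. n \<omega> = m \<and>
    (\<Sum>l<m. of_bool (l \<noteq> i \<and> dist (X i \<omega>) (X l \<omega>) < dist (X i \<omega>) (X j \<omega>))) < K)} =
    {\<omega>\<in>space F. (i, j) \<in> E \<omega>}"
    using E_iff by (auto simp: E_def)
  finally show ?thesis by (simp add: pred_def)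
qed

lemma E_M [measurable]: "Measurable.pred M (\<lambda>\<omega>. (i, j) \<in> E \<omega>)"
  by (rule from_F[OF E_F])

definition lab :: "nat \<Rightarrow> nat \<Rightarrow> 'w \<Rightarrow> bool" where
  "lab i j \<omega> \<longleftrightarrow> i < n \<omega> \<and> c \<omega> (X i \<omega>) = j"

lemma lab_M [measurable]: "Measurable.pred M (lab i j)"
  using lab_meas[of i j] by (simp add: lab_def pred_def)

definition T :: "'w \<Rightarrow> real" where
  "T \<omega> = cross_edge_count (Z \<omega>) (c \<omega>) (knn_edges K (Z \<omega>))"

definition T_mean :: "'w \<Rightarrow> real" where
  "T_mean \<omega> = mean_cross_edges (Z \<omega>) \<pi> (knn_edges K (Z \<omega>))"

text \<open>The fixed range \<open>m\<close> makes this a finite sum of measurable functions for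
  each \<open>m\<close>; it is meaningful where \<open>n \<omega> = m\<close>.\<close>

definition T_mean_idx :: "nat \<Rightarrow> 'w \<Rightarrow> real" where
  "T_mean_idx m \<omega> = (\<Sum>i<m. \<Sum>j<m. \<pi> (X i \<omega>) 1 * \<pi> (X j \<omega>) 2 * of_bool ((i, j) \<in> E \<omega>))"

lemma T_eq:
  assumes "\<omega> \<in> space M"
  shows "T \<omega> = (\<Sum>i<n \<omega>. \<Sum>j<n \<omega>. of_bool (lab i 1 \<omega> \<and> lab j 2 \<omega>) * of_bool ((i, j) \<in> E \<omega>))"
  unfolding T_def cross_edge_count_def sum.reindex_bij_betw[OF X_bij[OF assms], symmetric]
  by (intro sum.cong refl) (auto simp: lab_def E_def)

lemma T_mean_eq:
  assumes "\<omega> \<in> space M"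
  shows "T_mean \<omega> = T_mean_idx (n \<omega>) \<omega>"
  unfolding T_mean_def T_mean_idx_def mean_cross_edges_def sum.reindex_bij_betw[OF X_bij[OF assms], symmetric]
  by (intro sum.cong refl) (auto simp: E_def)

lemma T_M [measurable]: "T \<in> borel_measurable M"
proof -
  have "(\<lambda>\<omega>. (\<lambda>m \<omega>. \<Sum>i<m. \<Sum>j<m. of_bool (lab i 1 \<omega> \<and> lab j 2 \<omega>) * of_bool ((i, j) \<in> E \<omega>) :: real) (n \<omega>) \<omega>)
    \<in> borel_measurable M"
    by (rule measurable_compose_countable[OF _ n_M]) measurable
  then show ?thesis using T_eq by (simp cong: measurable_cong)
qed

lemma T_mean_idx_F [measurable]: "T_mean_idx m \<in> borel_measurable F"
  unfolding T_mean_idx_def by measurable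

lemma T_mean_M [measurable]: "T_mean \<in> borel_measurable M"
proof -
  have "(\<lambda>\<omega>. T_mean_idx (n \<omega>) \<omega>) \<in> borel_measurable M"
    by (rule measurable_compose_countable[OF _ n_M]) (rule from_F[OF T_mean_idx_F])
  then show ?thesis using T_mean_eq by (simp cong: measurable_cong)
qed

text \<open>All labels are 1 or 2, and \<open>S\<close> tells which indices carry label 1. On
  \<open>n \<omega> = m\<close> these events are disjoint for different subsets \<open>S\<close> of
  \<open>{..<m}\<close>, and \<open>W m S\<close> below is their conditional probability given the
  points.\<close>

definition A :: "nat set \<Rightarrow> 'w set" where
  "A S = {\<omega>\<in>space M. \<forall>i<n \<omega>. c \<omega> (X i \<omega>) = (if i \<in> S then 1 else 2)}"

lemma A_M [measurable]: "A S \<in> sets M"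
proof -
  have "{\<omega>\<in>space M. \<forall>i. i < n \<omega> \<longrightarrow> lab i (if i \<in> S then 1 else 2) \<omega>} \<in> sets M" by measurable
  also have "{\<omega>\<in>space M. \<forall>i. i < n \<omega> \<longrightarrow> lab i (if i \<in> S then 1 else 2) \<omega>} = A S"
    by (auto simp: A_def lab_def)
  finally show ?thesis .
qed

lemma T_on_A:
  assumes "\<omega> \<in> A S"
  shows "T \<omega> = cut_size (E \<omega>) {..<n \<omega>} S"
proof -
  have "lab i 1 \<omega> \<longleftrightarrow> i \<in> S" "lab i 2 \<omega> \<longleftrightarrow> i \<notin> S" if "i < n \<omega>" for i
    using assms that by (auto simp: A_def lab_def)
  then show ?thesis
    using assms by (auto simp: T_eq A_def cut_size_def intro!: sum.cong)
qed

definition W :: "nat \<Rightarrow> nat set \<Rightarrow> 'w \<Rightarrow> real" where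
  "W m S \<omega> = (\<Prod>i<m. \<pi> (X i \<omega>) (if i \<in> S then 1 else 2))"

lemma W_F [measurable]: "W m S \<in> borel_measurable F"
  unfolding W_def by measurable

lemma W_01: "0 \<le> W m S \<omega>" "W m S \<omega> \<le> 1"
  unfolding W_def using \<pi>_01 by (auto intro!: prod_nonneg prod_le_1)

text \<open>The factor \<open>G\<close> is known given the points, so it can be integrated against the conditional label law.\<close>
lemma integral_labels:
  assumes G [measurable]: "G \<in> borel_measurable F" and bnd: "\<And>\<omega>. \<bar>G \<omega>\<bar> \<le> B"
    and supp: "\<And>\<omega>. \<omega> \<in> space M \<Longrightarrow> n \<omega> \<noteq> m \<Longrightarrow> G \<omega> = 0"
  shows "integrable M (\<lambda>\<omega>. G \<omega> * indicator (A S) \<omega>)"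
    and "(\<integral>\<omega>. G \<omega> * indicator (A S) \<omega> \<partial>M) = (\<integral>\<omega>. G \<omega> * W m S \<omega> \<partial>M)"
proof -
  have [measurable]: "G \<in> borel_measurable M" by (rule from_F[OF G])
  show int: "integrable M (\<lambda>\<omega>. G \<omega> * indicat_real (A S) \<omega>)"
    by (rule integrable_const_bound[of _ B])
      (use bnd order_trans[OF abs_ge_zero bnd] in \<open>auto simp: indicator_def\<close>)
  have "(\<integral>\<omega>. G \<omega> * indicat_real (A S) \<omega> \<partial>M) = (\<integral>\<omega>. G \<omega> * real_cond_exp M F (indicat_real (A S)) \<omega> \<partial>M)"
    by (rule F.real_cond_exp_intg(2)[OF int, symmetric]) auto
  also have "\<dots> = (\<integral>\<omega>. G \<omega> * W m S \<omega> \<partial>M)"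
  proof (rule integral_cong_AE)
    have "W m S \<in> borel_measurable M" by (rule from_F[OF W_F])
    then show "(\<lambda>\<omega>. G \<omega> * W m S \<omega>) \<in> borel_measurable M" by measurable
    show "AE \<omega> in M. G \<omega> * real_cond_exp M F (indicat_real (A S)) \<omega> = G \<omega> * W m S \<omega>"
      using cond[of "\<lambda>i. if i \<in> S then 1 else 2"] AE_space
    proof eventually_elim
      case (elim \<omega>)
      then show ?case using supp[of \<omega>] by (cases "n \<omega> = m") (auto simp: A_def W_def)
    qed
  qed auto
  finally show "(\<integral>\<omega>. G \<omega> * indicat_real (A S) \<omega> \<partial>M) = (\<integral>\<omega>. G \<omega> * W m S \<omega> \<partial>M)" .
qed

text \<open>The bridge between the probability space and the finite calculus: on
  \<open>n \<omega> = m\<close>, averaging over the labels given the points is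
  \<open>subset_mean\<close> with weights \<open>\<pi> (X i \<omega>) 1\<close>. \<open>G\<close>
  may depend on the label set \<open>S\<close> but is otherwise a function of the points.\<close>

lemma sum_integral_labels:
  assumes G [measurable]: "\<And>S. G S \<in> borel_measurable F" and bnd: "\<And>S \<omega>. \<bar>G S \<omega>\<bar> \<le> B"
    and supp: "\<And>S \<omega>. \<omega> \<in> space M \<Longrightarrow> n \<omega> \<noteq> m \<Longrightarrow> G S \<omega> = 0"
  shows "(\<Sum>S\<in>Pow {..<m}. \<integral>\<omega>. G S \<omega> * indicator (A S) \<omega> \<partial>M) =
    (\<integral>\<omega>. subset_mean (\<lambda>i. \<pi> (X i \<omega>) 1) {..<m} (\<lambda>S. G S \<omega>) \<partial>M)"
    and "integrable M (\<lambda>\<omega>. subset_mean (\<lambda>i. \<pi> (X i \<omega>) 1) {..<m} (\<lambda>S. G S \<omega>))"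
proof -
  have [measurable]: "G S \<in> borel_measurable M" "W m S \<in> borel_measurable M" for S
    by (rule from_F[OF G], rule from_F[OF W_F])
  have B: "0 \<le> B" using bnd[of "{}" undefined] by linarith
  have int: "integrable M (\<lambda>\<omega>. W m S \<omega> * G S \<omega>)" for S
  proof (rule integrable_const_bound[of _ "1 * B"])
    show "AE \<omega> in M. norm (W m S \<omega> * G S \<omega>) \<le> 1 * B"
      unfolding real_norm_def abs_mult using bnd W_01 B by (intro AE_I2 mult_mono) auto
  qed measurable
  have ae: "AE \<omega> in M. (\<Sum>S\<in>Pow {..<m}. W m S \<omega> * G S \<omega>) =
      subset_mean (\<lambda>i. \<pi> (X i \<omega>) 1) {..<m} (\<lambda>S. G S \<omega>)"
    using \<pi>_sum AE_space
  proof eventually_elim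
    case (elim \<omega>)
    show ?case
    proof (cases "n \<omega> = m")
      case True
      have "X i \<omega> \<in> Z \<omega>" if "i < m" for i
        using X_bij[OF elim(2)] that True by (auto simp: bij_betw_def)
      then show ?thesis
        unfolding W_def using elim by (intro subset_mean_eq_sum_labels) auto
    qed (use supp elim(2) in \<open>simp add: subset_mean_def\<close>)
  qed
  have meas: "(\<lambda>\<omega>. subset_mean (\<lambda>i. \<pi> (X i \<omega>) 1) {..<m} (\<lambda>S. G S \<omega>)) \<in> borel_measurable M"
    unfolding subset_mean_def by measurable
  have "integrable M (\<lambda>\<omega>. \<Sum>S\<in>Pow {..<m}. W m S \<omega> * G S \<omega>)"
    using int by auto
  then show "integrable M (\<lambda>\<omega>. subset_mean (\<lambda>i. \<pi> (X i \<omega>) 1) {..<m} (\<lambda>S. G S \<omega>))"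
    by (subst (asm) integrable_cong_AE[OF _ meas ae]) measurable
  have "(\<Sum>S\<in>Pow {..<m}. \<integral>\<omega>. G S \<omega> * indicator (A S) \<omega> \<partial>M) = (\<Sum>S\<in>Pow {..<m}. \<integral>\<omega>. W m S \<omega> * G S \<omega> \<partial>M)"
    using integral_labels(2)[OF G bnd supp] by (simp add: mult.commute)
  also have "\<dots> = (\<integral>\<omega>. (\<Sum>S\<in>Pow {..<m}. W m S \<omega> * G S \<omega>) \<partial>M)"
    using int by simp
  also have "\<dots> = (\<integral>\<omega>. subset_mean (\<lambda>i. \<pi> (X i \<omega>) 1) {..<m} (\<lambda>S. G S \<omega>) \<partial>M)"
    by (intro integral_cong_AE[OF _ meas ae]) measurable
  finally show "(\<Sum>S\<in>Pow {..<m}. \<integral>\<omega>. G S \<omega> * indicator (A S) \<omega> \<partial>M) =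
    (\<integral>\<omega>. subset_mean (\<lambda>i. \<pi> (X i \<omega>) 1) {..<m} (\<lambda>S. G S \<omega>) \<partial>M)" .
qed

text \<open>The conditional law already has total mass 1 on labels 1 and 2: with \<open>G\<close>
  the indicator of \<open>n \<omega> = m\<close>, the disjoint events \<open>A S\<close> together
  have the full probability of that event.\<close>

lemma AE_labels_1_2: "AE \<omega> in M. \<exists>S\<in>Pow {..<n \<omega>}. \<omega> \<in> A S"
proof -
  let ?N = "\<lambda>m. {\<omega>\<in>space M. n \<omega> = m}"
  have "AE \<omega> in M. n \<omega> = m \<longrightarrow> \<omega> \<in> (\<Union>S\<in>Pow {..<m}. A S)" for m
  proof -
    let ?G = "indicat_real (?N m)"
    have "{\<omega>\<in>space F. n \<omega> = m} \<in> sets F" by measurable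
    then have [measurable]: "?N m \<in> sets F" by simp
    then have [measurable]: "?N m \<in> sets M" using F_sub by (auto simp: subalgebra_def)
    have "(\<Sum>S\<in>Pow {..<m}. \<integral>\<omega>. ?G \<omega> * indicator (A S) \<omega> \<partial>M) =
       (\<integral>\<omega>. subset_mean (\<lambda>i. \<pi> (X i \<omega>) 1) {..<m} (\<lambda>S. ?G \<omega>) \<partial>M)"
    proof (rule sum_integral_labels(1)[where B = 1])
      show "?G \<in> borel_measurable F" by (rule borel_measurable_indicator) fact
    qed (auto simp: indicator_def)
    also have "\<dots> = measure M (?N m)"
      by (simp add: subset_mean_const)
    also have "(\<Sum>S\<in>Pow {..<m}. \<integral>\<omega>. ?G \<omega> * indicator (A S) \<omega> \<partial>M) = (\<Sum>S\<in>Pow {..<m}. measure M (?N m \<inter> A S))"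
      by (simp flip: indicator_inter_arith)
    also have "\<dots> = measure M (\<Union>S\<in>Pow {..<m}. ?N m \<inter> A S)"
    proof (rule finite_measure_finite_Union[symmetric])
      show "disjoint_family_on (\<lambda>S. ?N m \<inter> A S) (Pow {..<m})"
      proof (unfold disjoint_family_on_def, intro ballI impI equals0I)
        fix S S' \<omega>
        assume S: "S \<in> Pow {..<m}" "S' \<in> Pow {..<m}" "S \<noteq> S'"
          and \<omega>: "\<omega> \<in> (?N m \<inter> A S) \<inter> (?N m \<inter> A S')"
        have eq: "(if i \<in> S then 1 else 2 :: nat) = (if i \<in> S' then 1 else 2)" if "i < m" for i
        proof -
          have "c \<omega> (X i \<omega>) = (if i \<in> S then 1 else 2)" "c \<omega> (X i \<omega>) = (if i \<in> S' then 1 else 2)"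
            using \<omega> that unfolding A_def by blast+
          then show ?thesis by simp
        qed
        have "i \<in> S \<longleftrightarrow> i \<in> S'" if "i < m" for i
          using eq[OF that] by (auto split: if_splits)
        then show False using S by blast
      qed
    qed auto
    also have "(\<Union>S\<in>Pow {..<m}. ?N m \<inter> A S) = {\<omega>\<in>space M. n \<omega> = m \<and> \<omega> \<in> (\<Union>S\<in>Pow {..<m}. A S)}"
      by auto
    finally have "measure M (?N m) - measure M {\<omega>\<in>space M. n \<omega> = m \<and> \<omega> \<in> (\<Union>S\<in>Pow {..<m}. A S)} = 0"
      by simp
    then have "measure M (?N m - {\<omega>\<in>space M. n \<omega> = m \<and> \<omega> \<in> (\<Union>S\<in>Pow {..<m}. A S)}) = 0"
      by (subst finite_measure_Diff) auto
    then have "AE \<omega> in M. \<omega> \<notin> ?N m - {\<omega>\<in>space M. n \<omega> = m \<and> \<omega> \<in> (\<Union>S\<in>Pow {..<m}. A S)}"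
      by (intro AE_not_in) (auto simp: null_sets_def emeasure_eq_measure)
    then show ?thesis using AE_space by eventually_elim auto
  qed
  then have "AE \<omega> in M. \<forall>m. n \<omega> = m \<longrightarrow> \<omega> \<in> (\<Union>S\<in>Pow {..<m}. A S)"
    unfolding AE_all_countable by blast
  then show ?thesis by eventually_elim blast
qed

text \<open>Chebyshev's inequality given the points. On each event \<open>n \<omega> = m\<close> the
  conditional variance is at most \<open>m * b\<^sup>2\<close> by bounded differences; the cap
  \<open>m0\<close> keeps the sum over \<open>m\<close> finite and bounds the factor
  \<open>m\<close>.\<close>

lemma label_concentration:
  assumes deg: "AE \<omega> in M. \<forall>x\<in>Z \<omega>.
      card {y. (x, y) \<in> knn_edges K (Z \<omega>)} + card {y. (y, x) \<in> knn_edges K (Z \<omega>)} \<le> b"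
    and t: "t > 0"
  shows "measure M {\<omega>\<in>space M. n \<omega> \<le> m0 \<and> t \<le> \<bar>T \<omega> - T_mean \<omega>\<bar>} \<le> real m0 * (real b)\<^sup>2 / t\<^sup>2"
proof -
  \<comment> \<open>The squared deviation that \<open>T\<close> would have if \<open>S\<close> were
    the set of indices with label 1. The crude bound on \<open>G\<close> below serves only
    integrability.\<close>
  define G where "G m S \<omega> = (if n \<omega> = m then (cut_size (E \<omega>) {..<m} S - T_mean_idx m \<omega>)\<^sup>2 else 0)" for m S \<omega>
  have G_F [measurable]: "G m S \<in> borel_measurable F" for m S
    unfolding G_def cut_size_def by measurable
  have [measurable]: "G m S \<in> borel_measurable M" for m S
    by (rule from_F[OF G_F])
  have G_bnd: "\<bar>G m S \<omega>\<bar> \<le> ((real m)\<^sup>2)\<^sup>2" for m S \<omega>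
  proof -
    have "T_mean_idx m \<omega> \<le> (\<Sum>i<m. \<Sum>j<m. 1)" "0 \<le> T_mean_idx m \<omega>"
      unfolding T_mean_idx_def using \<pi>_01
      by (intro sum_mono sum_nonneg; auto intro: mult_le_one)+
    then have "\<bar>cut_size (E \<omega>) {..<m} S - T_mean_idx m \<omega>\<bar> \<le> (real m)\<^sup>2"
      using cut_size_bounds[of "{..<m}" "E \<omega>" S] by (auto simp: power2_eq_square)
    then show ?thesis
      unfolding G_def using power_mono[of "\<bar>cut_size (E \<omega>) {..<m} S - T_mean_idx m \<omega>\<bar>" "(real m)\<^sup>2" 2] by simp
  qed
  have G_supp: "G m S \<omega> = 0" if "n \<omega> \<noteq> m" for m S \<omega>
    using that by (simp add: G_def)
  have eq: "(\<Sum>S\<in>Pow {..<m}. \<integral>\<omega>. G m S \<omega> * indicator (A S) \<omega> \<partial>M) =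
    (\<integral>\<omega>. subset_mean (\<lambda>i. \<pi> (X i \<omega>) 1) {..<m} (\<lambda>S. G m S \<omega>) \<partial>M)" for m
    by (rule sum_integral_labels(1)[OF G_F G_bnd]) (rule G_supp)
  have G_int: "(\<Sum>S\<in>Pow {..<m}. \<integral>\<omega>. G m S \<omega> * indicator (A S) \<omega> \<partial>M) \<le>
    (\<integral>\<omega>. indicator {\<omega>\<in>space M. n \<omega> = m} \<omega> * (real m * (real b)\<^sup>2) \<partial>M)" for m
    unfolding eq
  proof (rule integral_mono_AE)
    show "integrable M (\<lambda>\<omega>. subset_mean (\<lambda>i. \<pi> (X i \<omega>) 1) {..<m} (\<lambda>S. G m S \<omega>))"
      by (rule sum_integral_labels(2)[OF G_F G_bnd G_supp])
    show "AE \<omega> in M. subset_mean (\<lambda>i. \<pi> (X i \<omega>) 1) {..<m} (\<lambda>S. G m S \<omega>) \<le>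
      indicator {\<omega>\<in>space M. n \<omega> = m} \<omega> * (real m * (real b)\<^sup>2)"
      using \<pi>_sum deg AE_space
    proof eventually_elim
      case (elim \<omega>)
      show ?case
      proof (cases "n \<omega> = m")
        case True
        have bij: "bij_betw (\<lambda>i. X i \<omega>) {..<m} (Z \<omega>)" using X_bij[OF elim(3)] True by simp
        then have XZ: "X i \<omega> \<in> Z \<omega>" if "i < m" for i using that by (auto simp: bij_betw_def)
        have inj: "inj_on (\<lambda>i. X i \<omega>) {..<m}" using bij by (auto simp: bij_betw_def)
        have fin: "finite (Z \<omega>)" by (rule poisson_process_finite[OF pp elim(3)])
        have "card {j\<in>{..<m}. (k, j) \<in> E \<omega>} + card {i\<in>{..<m}. (i, k) \<in> E \<omega>} \<le> b" if k: "k < m" for k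
        proof -
          have "card {j\<in>{..<m}. (k, j) \<in> E \<omega>} = card ((\<lambda>i. X i \<omega>) ` {j\<in>{..<m}. (k, j) \<in> E \<omega>})"
            by (rule card_image[symmetric]) (rule inj_on_subset[OF inj], auto)
          also have "\<dots> \<le> card {y. (X k \<omega>, y) \<in> knn_edges K (Z \<omega>)}"
            by (rule card_mono) (auto simp: E_def knn_edges_def intro: finite_subset[OF _ fin])
          finally have 1: "card {j\<in>{..<m}. (k, j) \<in> E \<omega>} \<le> card {y. (X k \<omega>, y) \<in> knn_edges K (Z \<omega>)}" .
          have "card {i\<in>{..<m}. (i, k) \<in> E \<omega>} = card ((\<lambda>i. X i \<omega>) ` {i\<in>{..<m}. (i, k) \<in> E \<omega>})"
            by (rule card_image[symmetric]) (rule inj_on_subset[OF inj], auto)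
          also have "\<dots> \<le> card {y. (y, X k \<omega>) \<in> knn_edges K (Z \<omega>)}"
            by (rule card_mono) (auto simp: E_def knn_edges_def intro: finite_subset[OF _ fin])
          finally have 2: "card {i\<in>{..<m}. (i, k) \<in> E \<omega>} \<le> card {y. (y, X k \<omega>) \<in> knn_edges K (Z \<omega>)}" .
          show ?thesis using 1 2 elim(2) XZ[OF k] by fastforce
        qed
        moreover have "irrefl (E \<omega>)" by (auto simp: irrefl_def E_def knn_edges_def)
        ultimately have "subset_mean (\<lambda>i. \<pi> (X i \<omega>) 1) {..<m} (\<lambda>S. (cut_size (E \<omega>) {..<m} S -
            (\<Sum>i<m. \<Sum>j<m. \<pi> (X i \<omega>) 1 * (1 - \<pi> (X j \<omega>) 1) * of_bool ((i, j) \<in> E \<omega>)))\<^sup>2)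
          \<le> real (card {..<m}) * (real b)\<^sup>2"
          using \<pi>_01 by (intro cut_size_variance) auto
        also have "(\<Sum>i<m. \<Sum>j<m. \<pi> (X i \<omega>) 1 * (1 - \<pi> (X j \<omega>) 1) * of_bool ((i, j) \<in> E \<omega>)) = T_mean_idx m \<omega>"
          unfolding T_mean_idx_def
        proof (intro sum.cong refl)
          fix i j assume "i \<in> {..<m}" "j \<in> {..<m}"
          then have "1 - \<pi> (X j \<omega>) 1 = \<pi> (X j \<omega>) 2" using elim(1) XZ[of j] by force
          then show "\<pi> (X i \<omega>) 1 * (1 - \<pi> (X j \<omega>) 1) * of_bool ((i, j) \<in> E \<omega>) =
            \<pi> (X i \<omega>) 1 * \<pi> (X j \<omega>) 2 * of_bool ((i, j) \<in> E \<omega>)" by simp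
        qed
        finally show ?thesis using True elim(3) by (simp add: G_def)
      qed (simp add: G_def subset_mean_def)
    qed
    have "{\<omega>\<in>space M. n \<omega> = m} \<in> sets M" by measurable
    then show "integrable M (\<lambda>\<omega>. indicator {\<omega>\<in>space M. n \<omega> = m} \<omega> * (real m * (real b)\<^sup>2))"
      by (intro integrable_mult_left integrable_real_indicator) (auto simp: emeasure_eq_measure)
  qed
  let ?Bad = "{\<omega>\<in>space M. n \<omega> \<le> m0 \<and> t \<le> \<bar>T \<omega> - T_mean \<omega>\<bar>}"
  have [measurable]: "?Bad \<in> sets M" by measurable
  have int: "integrable M (\<lambda>\<omega>. G m S \<omega> * indicator (A S) \<omega>)" for m S
    by (rule integral_labels(1)[OF G_F G_bnd G_supp])
  have "t\<^sup>2 * measure M ?Bad = (\<integral>\<omega>. t\<^sup>2 * indicator ?Bad \<omega> \<partial>M)" by simp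
  \<comment> \<open>Markov: on the bad event the term for the actual number of points and the actual
    label set is at least \<open>t\<^sup>2\<close>, and all other terms are nonnegative.\<close>
  also have "\<dots> \<le> (\<integral>\<omega>. (\<Sum>m\<le>m0. \<Sum>S\<in>Pow {..<m}. G m S \<omega> * indicator (A S) \<omega>) \<partial>M)"
  proof (rule integral_mono_AE)
    show "AE \<omega> in M. t\<^sup>2 * indicator ?Bad \<omega> \<le> (\<Sum>m\<le>m0. \<Sum>S\<in>Pow {..<m}. G m S \<omega> * indicator (A S) \<omega>)"
      using AE_labels_1_2 AE_space
    proof eventually_elim
      case (elim \<omega>)
      have Gnn: "0 \<le> G m S \<omega>" for m S by (simp add: G_def)
      then have nn: "0 \<le> G m S \<omega> * indicator (A S) \<omega>" for m S by simp
      show ?case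
      proof (cases "\<omega> \<in> ?Bad")
        case True
        obtain S where S: "S \<in> Pow {..<n \<omega>}" "\<omega> \<in> A S" using elim by auto
        have "t\<^sup>2 \<le> \<bar>T \<omega> - T_mean \<omega>\<bar>\<^sup>2" using True t by (intro power_mono) auto
        also have "\<dots> = G (n \<omega>) S \<omega> * indicator (A S) \<omega>"
          using S elim(2) by (simp add: G_def T_on_A T_mean_eq)
        also have "\<dots> \<le> (\<Sum>S\<in>Pow {..<n \<omega>}. G (n \<omega>) S \<omega> * indicator (A S) \<omega>)"
          using S nn by (intro member_le_sum) auto
        also have "\<dots> \<le> (\<Sum>m\<le>m0. \<Sum>S\<in>Pow {..<m}. G m S \<omega> * indicator (A S) \<omega>)"
          using True Gnn
          by (intro member_le_sum[of "n \<omega>" "{..m0}" "\<lambda>m. \<Sum>S\<in>Pow {..<m}. G m S \<omega> * indicator (A S) \<omega>"])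
            (auto intro!: sum_nonneg)
        finally show ?thesis using True by simp
      qed (use Gnn in \<open>auto intro!: sum_nonneg\<close>)
    qed
    show "integrable M (\<lambda>\<omega>. t\<^sup>2 * indicator ?Bad \<omega>)"
      by (intro integrable_mult_right integrable_real_indicator) (auto simp: emeasure_eq_measure)
    show "integrable M (\<lambda>\<omega>. \<Sum>m\<le>m0. \<Sum>S\<in>Pow {..<m}. G m S \<omega> * indicator (A S) \<omega>)"
      by (intro Bochner_Integration.integrable_sum int)
  qed
  also have "\<dots> = (\<Sum>m\<le>m0. \<Sum>S\<in>Pow {..<m}. \<integral>\<omega>. G m S \<omega> * indicator (A S) \<omega> \<partial>M)"
    by (simp only: Bochner_Integration.integral_sum Bochner_Integration.integrable_sum int)
  also have "\<dots> \<le> (\<Sum>m\<le>m0. \<integral>\<omega>. indicator {\<omega>\<in>space M. n \<omega> = m} \<omega> * (real m * (real b)\<^sup>2) \<partial>M)"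
    by (intro sum_mono G_int)
  also have "\<dots> = (\<Sum>m\<le>m0. measure M {\<omega>\<in>space M. n \<omega> = m} * (real m * (real b)\<^sup>2))"
    by simp
  also have "\<dots> \<le> (\<Sum>m\<le>m0. measure M {\<omega>\<in>space M. n \<omega> = m} * (real m0 * (real b)\<^sup>2))"
    by (intro sum_mono mult_left_mono mult_right_mono) auto
  also have "\<dots> = measure M (\<Union>m\<in>{..m0}. {\<omega>\<in>space M. n \<omega> = m}) * (real m0 * (real b)\<^sup>2)"
    by (subst finite_measure_finite_Union) (auto simp: disjoint_family_on_def sum_distrib_right)
  also have "\<dots> \<le> 1 * (real m0 * (real b)\<^sup>2)"
    by (intro mult_right_mono) auto
  finally show ?thesis using t by (simp add: field_simps)
qed

end

subsection \<open>Sums over nearest-neighbor edges\<close>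

text \<open>A weight at the source of an edge is counted with the out-degree, a weight at the target
  with the in-degree.\<close>

lemma sum_edges_swap:
  assumes "finite S"
  shows "(\<Sum>y\<in>S. \<Sum>z\<in>S. of_bool ((y, z) \<in> E) * (s y + t z)) =
    (\<Sum>y\<in>S. s y * real (card {z\<in>S. (y, z) \<in> E})) + (\<Sum>z\<in>S. t z * real (card {y\<in>S. (y, z) \<in> E}))"
proof -
  have card: "(\<Sum>z\<in>S. of_bool (P z)) = real (card {z\<in>S. P z})" for P
    using assms by (simp add: of_bool_def sum.If_cases Int_def)
  have "(\<Sum>y\<in>S. \<Sum>z\<in>S. of_bool ((y, z) \<in> E) * (s y + t z)) =
    (\<Sum>y\<in>S. \<Sum>z\<in>S. s y * of_bool ((y, z) \<in> E)) + (\<Sum>y\<in>S. \<Sum>z\<in>S. t z * of_bool ((y, z) \<in> E))"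
    by (simp only: distrib_left distrib_right sum.distrib mult.commute)
  also have "(\<Sum>y\<in>S. \<Sum>z\<in>S. t z * of_bool ((y, z) \<in> E)) = (\<Sum>z\<in>S. \<Sum>y\<in>S. t z * of_bool ((y, z) \<in> E))"
    by (rule sum.swap)
  finally show ?thesis by (simp only: card flip: sum_distrib_left)
qed

lemma abs_mult_diff_le:
  fixes a b :: real
  assumes "\<bar>a'\<bar> \<le> 1" "\<bar>b\<bar> \<le> 1"
  shows "\<bar>a' * b' - a * b\<bar> \<le> \<bar>a' - a\<bar> + \<bar>b' - b\<bar>"
proof -
  have "a' * b' - a * b = a' * (b' - b) + (a' - a) * b" by (simp add: algebra_simps)
  then have "\<bar>a' * b' - a * b\<bar> \<le> \<bar>a'\<bar> * \<bar>b' - b\<bar> + \<bar>a' - a\<bar> * \<bar>b\<bar>"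
    by (metis abs_mult abs_triangle_ineq)
  also have "\<dots> \<le> 1 * \<bar>b' - b\<bar> + \<bar>a' - a\<bar> * 1"
    using assms by (intro add_mono mult_right_mono mult_left_mono) auto
  finally show ?thesis by simp
qed

text \<open>Along an edge, \<open>h' z\<close> is replaced in turn by \<open>h z\<close>,
  \<open>v z\<close>, \<open>v y\<close> and \<open>h y\<close>. The three errors \<open>e\<close>
  come from \<open>a'\<close>, \<open>h'\<close> and the variation of \<open>v\<close>. The
  difference of \<open>h\<close> and \<open>v\<close> is paid at the source with weight
  \<open>K\<close> and at the target with weight at most \<open>C * K\<close>, whence the factor
  \<open>C + 1\<close>.\<close>

lemma edge_sum_approx:
  fixes a a' h h' v :: "'a \<Rightarrow> real"
  assumes S: "finite S"
    and out: "\<And>y. y \<in> S \<Longrightarrow> card {z\<in>S. (y, z) \<in> E} = K"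
    and indeg: "\<And>z. z \<in> S \<Longrightarrow> card {y\<in>S. (y, z) \<in> E} \<le> C * K"
    and a': "\<And>y. 0 \<le> a' y \<and> a' y \<le> 1" and h: "\<And>y. 0 \<le> h y \<and> h y \<le> 1"
    and v: "\<And>y. 0 \<le> v y \<and> v y \<le> 1"
    and aa': "\<And>y. \<bar>a' y - a y\<bar> \<le> e" and hh': "\<And>y. \<bar>h' y - h y\<bar> \<le> e"
    and good: "\<And>y z. y \<in> S - B \<Longrightarrow> z \<in> S \<Longrightarrow> (y, z) \<in> E \<Longrightarrow> \<bar>v z - v y\<bar> \<le> e"
    and B: "B \<subseteq> S" and e: "0 \<le> e"
  shows "\<bar>(\<Sum>y\<in>S. \<Sum>z\<in>S. a' y * h' z * of_bool ((y, z) \<in> E)) - real K * (\<Sum>y\<in>S. a y * h y)\<bar>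
    \<le> real K * (3 * e * real (card S) + (real C + 1) * (\<Sum>y\<in>S. \<bar>h y - v y\<bar>) + real (card B))"
proof -
  define s where "s y = 3 * e + \<bar>h y - v y\<bar> + indicator B y" for y
  have "real K * (\<Sum>y\<in>S. a y * h y) = (\<Sum>y\<in>S. a y * h y * real (card {z\<in>S. (y, z) \<in> E}))"
    unfolding sum_distrib_left by (intro sum.cong refl) (simp add: out)
  also have "\<dots> = (\<Sum>y\<in>S. \<Sum>z\<in>S. of_bool ((y, z) \<in> E) * (a y * h y))"
    using sum_edges_swap[OF S, of E "\<lambda>y. a y * h y" "\<lambda>_. 0"] by simp
  finally have "(\<Sum>y\<in>S. \<Sum>z\<in>S. a' y * h' z * of_bool ((y, z) \<in> E)) - real K * (\<Sum>y\<in>S. a y * h y) =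
    (\<Sum>y\<in>S. \<Sum>z\<in>S. of_bool ((y, z) \<in> E) * (a' y * h' z - a y * h y))"
    by (simp only: sum_subtractf[symmetric] right_diff_distrib mult.commute)
  also have "\<bar>\<dots>\<bar> \<le> (\<Sum>y\<in>S. \<Sum>z\<in>S. \<bar>of_bool ((y, z) \<in> E) * (a' y * h' z - a y * h y)\<bar>)"
    by (intro order_trans[OF sum_abs] sum_mono sum_abs)
  also have "\<dots> \<le> (\<Sum>y\<in>S. \<Sum>z\<in>S. of_bool ((y, z) \<in> E) * (s y + \<bar>h z - v z\<bar>))"
  proof (intro sum_mono)
    fix y z assume yz: "y \<in> S" "z \<in> S"
    show "\<bar>of_bool ((y, z) \<in> E) * (a' y * h' z - a y * h y)\<bar> \<le> of_bool ((y, z) \<in> E) * (s y + \<bar>h z - v z\<bar>)"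
    proof (cases "(y, z) \<in> E")
      case True
      have "\<bar>a' y * h' z - a y * h y\<bar> \<le> \<bar>a' y - a y\<bar> + \<bar>h' z - h y\<bar>"
        using a' h by (intro abs_mult_diff_le) auto
      \<comment> \<open>For a source in \<open>B\<close> the trivial bound 1 is used.\<close>
      moreover have "\<bar>v z - v y\<bar> \<le> e + indicator B y"
        using good[of y z] yz True v[of z] v[of y] e by (cases "y \<in> B") (auto simp: abs_le_iff)
      moreover have "\<bar>h' z - h y\<bar> \<le> \<bar>h' z - h z\<bar> + \<bar>h z - v z\<bar> + \<bar>v z - v y\<bar> + \<bar>h y - v y\<bar>"
        by linarith
      ultimately show ?thesis
        using aa'[of y] hh'[of z] True unfolding s_def by simp
    qed simp
  qed
  also have "\<dots> = (\<Sum>y\<in>S. s y * real (card {z\<in>S. (y, z) \<in> E})) +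
      (\<Sum>z\<in>S. \<bar>h z - v z\<bar> * real (card {y\<in>S. (y, z) \<in> E}))"
    by (rule sum_edges_swap[OF S])
  also have "\<dots> \<le> (\<Sum>y\<in>S. s y * real K) + (\<Sum>z\<in>S. \<bar>h z - v z\<bar> * (real C * real K))"
  proof (intro add_mono sum_mono mult_left_mono)
    fix z assume "z \<in> S"
    from indeg[OF this] show "real (card {y\<in>S. (y, z) \<in> E}) \<le> real C * real K"
      by (metis of_nat_le_iff of_nat_mult)
  qed (use e in \<open>auto simp: out s_def\<close>)
  also have "\<dots> = real K * (3 * e * real (card S) + (real C + 1) * (\<Sum>y\<in>S. \<bar>h y - v y\<bar>) + (\<Sum>y\<in>S. indicator B y))"
    by (simp add: s_def sum.distrib algebra_simps sum_distrib_left)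
  also have "(\<Sum>y\<in>S. indicator B y) = real (card B)"
    using S B by (simp add: indicator_def sum.If_cases Int_absorb1 of_bool_def)
  finally show ?thesis .
qed

text \<open>A measurable function is almost everywhere a limit of continuous ones. Clipping these to
  the unit interval keeps the limit and supplies the bound for dominated convergence under the
  finite measure.\<close>

lemma continuous_L1_approximation:
  fixes h :: "'a::euclidean_space \<Rightarrow> real" and \<phi> :: "'a \<Rightarrow> real"
  assumes [measurable]: "h \<in> borel_measurable borel" "\<phi> \<in> borel_measurable borel"
    and h: "\<And>x. 0 \<le> h x \<and> h x \<le> 1"
    and fin: "finite_measure (density lborel \<phi>)" and e: "e > 0"
  obtains v where "continuous_on UNIV v" "\<And>x. 0 \<le> v x \<and> v x \<le> 1"
    "(\<integral>x. \<bar>h x - v x\<bar> \<partial>density lborel \<phi>) < e"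
proof -
  interpret finite_measure "density lborel \<phi>" by (rule fin)
  have "h measurable_on UNIV"
  proof (rule lebesgue_measurable_imp_measurable_on)
    show "h \<in> borel_measurable lebesgue" by (rule measurable_completion) simp
  qed simp
  then obtain D g where Dg: "negligible D \<and> (\<forall>n. continuous_on UNIV (g n)) \<and>
      (\<forall>x. x \<notin> D \<longrightarrow> (\<lambda>n. g n x) \<longlonglongrightarrow> (if x \<in> UNIV then h x else 0))"
    unfolding measurable_on_def by (elim exE)
  then have D: "negligible D" and g: "continuous_on UNIV (g n)"
      and lim: "x \<notin> D \<Longrightarrow> (\<lambda>n. g n x) \<longlonglongrightarrow> h x" for n x
    by simp_all
  define v where "v n x = max 0 (min 1 (g n x))" for n x
  have v: "continuous_on UNIV (v n)" "0 \<le> v n x" "v n x \<le> 1" for n x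
    unfolding v_def using g by (auto intro!: continuous_intros)
  have [measurable]: "v n \<in> borel_measurable borel" for n
    by (rule borel_measurable_continuous_onI[OF v(1)])
  have "AE x in lebesgue. x \<notin> D"
    using D by (intro AE_not_in) (simp add: negligible_iff_null_sets)
  then have "AE x in lborel. x \<notin> D" by (simp add: AE_completion_iff)
  then have "AE x in lborel. (\<lambda>n. v n x) \<longlonglongrightarrow> h x"
  proof eventually_elim
    case (elim x)
    have "(\<lambda>n. v n x) \<longlonglongrightarrow> max 0 (min 1 (h x))"
      unfolding v_def by (intro tendsto_intros tendsto_max tendsto_min lim elim)
    then show ?case using h[of x] by simp
  qed
  then have ae: "AE x in density lborel \<phi>. (\<lambda>n. \<bar>h x - v n x\<bar>) \<longlonglongrightarrow> 0"
    by (subst AE_density) (auto elim!: eventually_mono intro!: tendsto_rabs_zero LIM_zero simp: tendsto_rabs_zero_iff LIM_zero_iff abs_minus_commute[of "h _"])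
  have "(\<lambda>n. \<integral>x. \<bar>h x - v n x\<bar> \<partial>density lborel \<phi>) \<longlonglongrightarrow> (\<integral>x. 0 \<partial>density lborel \<phi>)"
  proof (rule integral_dominated_convergence[OF _ _ _ ae])
    show "integrable (density lborel \<phi>) (\<lambda>x. 1 :: real)" by simp
    show "AE x in density lborel \<phi>. norm \<bar>h x - v n x\<bar> \<le> 1" for n
    proof (rule AE_I2)
      show "norm \<bar>h x - v n x\<bar> \<le> 1" for x
        using h[of x] v(2)[where n = n and x = x] v(3)[where n = n and x = x]
        unfolding real_norm_def abs_idempotent by linarith
    qed
  qed auto
  then have "\<forall>\<^sub>F n in sequentially. (\<integral>x. \<bar>h x - v n x\<bar> \<partial>density lborel \<phi>) < e"
    using e by (intro order_tendstoD(2)) auto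
  then obtain n where "(\<integral>x. \<bar>h x - v n x\<bar> \<partial>density lborel \<phi>) < e"
    using eventually_happens[of _ sequentially] by force
  then show thesis using v that by blast
qed

text \<open>From here on the process enters only through the limiting proportion of points in each
  fixed Borel set and the absence of ties. \<open>Z\<close> takes pairs so that it can be used
  directly along \<open>in_prob M\<close>.\<close>

locale knn_asymptotics =
  fixes M :: "nat \<Rightarrow> 'w measure" and Z :: "nat \<times> 'w \<Rightarrow> 'a::euclidean_space set"
    and \<phi> :: "'a \<Rightarrow> real" and K :: "nat \<Rightarrow> nat"
  assumes \<phi> [measurable]: "\<phi> \<in> borel_measurable borel"
    and prob: "prob_space (density lborel \<phi>)"
    and fin: "\<forall>\<^sub>F x in in_prob M. finite (Z x)"
    and cnt: "\<And>A. A \<in> sets borel \<Longrightarrow>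
      ((\<lambda>x. real (card (Z x \<inter> A)) / real (fst x)) \<longlongrightarrow> measure (density lborel \<phi>) A) (in_prob M)"
    and ties: "\<forall>\<^sub>F x in in_prob M. tie_free (Z x)"
    and K_pos: "\<forall>\<^sub>F N in sequentially. 1 \<le> K N"
    and K_small: "(\<lambda>N. real (K N) / real N) \<longlonglongrightarrow> 0"
begin

abbreviation \<mu> :: "'a measure" where "\<mu> \<equiv> density lborel \<phi>"

sublocale \<mu>: prob_space \<mu> by (rule prob)

section \<open>Consequences of the convergence of counts\<close>

lemma N_pos: "\<forall>\<^sub>F x in in_prob M. 0 < fst x"
  by (rule eventually_fst_in_prob[OF eventually_gt_at_top])

lemma card_Z_le: "\<forall>\<^sub>F x in in_prob M. real (card (Z x)) \<le> 2 * real (fst x)"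
proof -
  have "((\<lambda>x. real (card (Z x)) / real (fst x)) \<longlongrightarrow> 1) (in_prob M)"
    using cnt[of UNIV] \<mu>.prob_space by simp
  then have "\<forall>\<^sub>F x in in_prob M. real (card (Z x)) / real (fst x) < 2"
    by (rule order_tendstoD) simp
  with N_pos show ?thesis by eventually_elim (simp add: field_simps)
qed

lemma law_of_large_numbers:
  assumes [measurable]: "w \<in> borel_measurable borel" and w: "\<And>y. 0 \<le> w y \<and> w y \<le> 1"
  shows "((\<lambda>x. (\<Sum>y\<in>Z x. w y) / real (fst x)) \<longlongrightarrow> (\<integral>y. w y \<partial>\<mu>)) (in_prob M)"
proof (rule tendstoI)
  fix e :: real assume e: "e > 0"
  \<comment> \<open>Three errors must fit into \<open>e\<close>: \<open>2 / m\<close> from the sum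
    over at most \<open>2 N\<close> points, \<open>1 / m\<close> from the integral, and the
    deviation of the counts, for which \<open>e - 3 / m > 0\<close> remains.\<close>
  define m where "m = Suc (nat \<lceil>4 / e\<rceil>)"
  have m: "m > 0" by (simp add: m_def)
  have "4 / e < real m" unfolding m_def by linarith
  then have me: "4 / real m < e" using e m by (simp add: field_simps)
  define A where "A i = {y. real i / real m \<le> w y}" for i
  have A_sets [measurable]: "A i \<in> sets borel" for i
  proof -
    have "{y\<in>space borel. real i / real m \<le> w y} \<in> sets borel" by measurable
    then show ?thesis by (simp add: A_def)
  qed
  \<comment> \<open>\<open>s y\<close> is \<open>w y\<close> rounded down to a multiple of
    \<open>1 / m\<close>, written as a combination of indicators of superlevel sets, so that the
    convergence of finitely many counts suffices.\<close>
  define s where "s y = (\<Sum>i\<in>{1..m}. 1 / real m * indicator (A i) y)" for y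
  have s: "s y \<le> w y" "w y \<le> s y + 1 / real m" for y
  proof -
    define j where "j = nat \<lfloor>real m * w y\<rfloor>"
    have mw: "0 \<le> real m * w y" "real m * w y \<le> real m"
      using w[of y] by (auto simp: mult_left_le)
    then have j: "real j \<le> real m * w y" "real m * w y < real j + 1"
      unfolding j_def by linarith+
    have iff: "y \<in> A i \<longleftrightarrow> i \<le> j" for i
    proof -
      have "y \<in> A i \<longleftrightarrow> real i \<le> real m * w y" using m by (simp add: A_def field_simps)
      also have "\<dots> \<longleftrightarrow> i \<le> j" using j by linarith
      finally show ?thesis .
    qed
    have "j \<le> m" using j mw by linarith
    then have "{i\<in>{1..m}. y \<in> A i} = {1..j}" unfolding iff by auto
    then have "s y = real j / real m"
      unfolding s_def sum_distrib_left[symmetric]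
      by (simp add: indicator_def of_bool_def sum.If_cases Int_def)
    then show "s y \<le> w y" "w y \<le> s y + 1 / real m"
      using j m by (simp_all add: pos_divide_le_eq pos_le_divide_eq mult.commute flip: add_divide_distrib)
  qed
  have "((\<lambda>x. \<Sum>i\<in>{1..m}. 1 / real m * (real (card (Z x \<inter> A i)) / real (fst x)))
    \<longlongrightarrow> (\<Sum>i\<in>{1..m}. 1 / real m * measure \<mu> (A i))) (in_prob M)"
    by (intro tendsto_sum tendsto_mult tendsto_const cnt A_sets)
  also have "(\<Sum>i\<in>{1..m}. 1 / real m * measure \<mu> (A i)) = (\<integral>y. s y \<partial>\<mu>)"
    unfolding s_def by (subst Bochner_Integration.integral_sum) (auto simp: \<mu>.emeasure_eq_measure)
  finally have "\<forall>\<^sub>F x in in_prob M. dist (\<Sum>i\<in>{1..m}. 1 / real m * (real (card (Z x \<inter> A i)) / real (fst x)))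
      (\<integral>y. s y \<partial>\<mu>) < e - 3 / real m"
    using me m e by (intro tendstoD) (auto simp: field_simps)
  then show "\<forall>\<^sub>F x in in_prob M. dist ((\<Sum>y\<in>Z x. w y) / real (fst x)) (\<integral>y. w y \<partial>\<mu>) < e"
    using fin card_Z_le N_pos
  proof eventually_elim
    case (elim x)
    have card: "(\<Sum>y\<in>Z x. indicator B y) = real (card (Z x \<inter> B))" for B
      using elim(2) by (simp add: indicator_def of_bool_def sum.If_cases Int_def)
    have "(\<Sum>y\<in>Z x. s y) = (\<Sum>i\<in>{1..m}. 1 / real m * real (card (Z x \<inter> A i)))"
      unfolding s_def by (subst sum.swap) (simp only: card flip: sum_distrib_left)
    then have sum_s: "(\<Sum>y\<in>Z x. s y) / real (fst x) =
        (\<Sum>i\<in>{1..m}. 1 / real m * (real (card (Z x \<inter> A i)) / real (fst x)))"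
      by (simp add: sum_divide_distrib)
    have "(\<Sum>y\<in>Z x. s y) \<le> (\<Sum>y\<in>Z x. w y)" "(\<Sum>y\<in>Z x. w y) \<le> (\<Sum>y\<in>Z x. s y + 1 / real m)"
      using s by (auto intro: sum_mono)
    moreover have "real (card (Z x)) / real m \<le> 2 * real (fst x) / real m"
      using elim by (intro divide_right_mono) auto
    ultimately have "\<bar>(\<Sum>y\<in>Z x. w y) - (\<Sum>y\<in>Z x. s y)\<bar> \<le> 2 * real (fst x) / real m"
      by (simp add: sum.distrib)
    then have "\<bar>(\<Sum>y\<in>Z x. w y) - (\<Sum>y\<in>Z x. s y)\<bar> / real (fst x) \<le> 2 / real m"
      using elim by (simp add: field_simps)
    then have 1: "\<bar>(\<Sum>y\<in>Z x. w y) / real (fst x) - (\<Sum>y\<in>Z x. s y) / real (fst x)\<bar> \<le> 2 / real m"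
      by (simp flip: diff_divide_distrib)
    have s01: "0 \<le> s y" "s y \<le> 1" for y
      using s(1)[of y] w[of y] by (auto simp: s_def intro: sum_nonneg order_trans)
    have [measurable]: "s \<in> borel_measurable borel" unfolding s_def by measurable
    have int: "integrable \<mu> w" "integrable \<mu> s"
      by (rule \<mu>.integrable_const_bound[of _ 1]; use w s01 in simp)+
    have "(\<integral>y. s y \<partial>\<mu>) \<le> (\<integral>y. w y \<partial>\<mu>)"
      by (rule integral_mono) (use int s in auto)
    moreover have "(\<integral>y. w y \<partial>\<mu>) \<le> (\<integral>y. s y + 1 / real m \<partial>\<mu>)"
      by (rule integral_mono) (use int s in auto)
    moreover have "(\<integral>y. s y + 1 / real m \<partial>\<mu>) = (\<integral>y. s y \<partial>\<mu>) + 1 / real m"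
      using int \<mu>.prob_space by simp
    ultimately have 2: "\<bar>(\<integral>y. w y \<partial>\<mu>) - (\<integral>y. s y \<partial>\<mu>)\<bar> \<le> 1 / real m"
      by linarith
    have "3 / real m = 1 / real m + 2 / real m" by (simp add: field_simps)
    then show ?case
      using 1 2 elim(1) unfolding sum_s dist_real_def by linarith
  qed
qed

text \<open>A set of positive mass contains a number of points of order \<open>N\<close>, which
  exceeds \<open>K = o(N)\<close>.\<close>

lemma card_gt_K:
  assumes A: "A \<in> sets borel" and pos: "measure \<mu> A > 0"
  shows "\<forall>\<^sub>F x in in_prob M. K (fst x) < card (Z x \<inter> A)"
proof -
  let ?d = "measure \<mu> A / 2"
  have "\<forall>\<^sub>F x in in_prob M. ?d < real (card (Z x \<inter> A)) / real (fst x)"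
    using cnt[OF A] pos by (intro order_tendstoD(1)) auto
  moreover have "\<forall>\<^sub>F x in in_prob M. real (K (fst x)) / real (fst x) < ?d"
    using tendsto_fst_in_prob[OF K_small] pos by (intro order_tendstoD(2)) auto
  ultimately show ?thesis
    using N_pos
  proof eventually_elim
    case (elim x)
    then have "real (K (fst x)) / real (fst x) < real (card (Z x \<inter> A)) / real (fst x)" by linarith
    then show ?case using elim(3) by (simp add: divide_less_cancel)
  qed
qed

lemma outdegree: "\<forall>\<^sub>F x in in_prob M. \<forall>y\<in>Z x. card {z\<in>Z x. (y, z) \<in> knn_edges (K (fst x)) (Z x)} = K (fst x)"
proof -
  have "\<forall>\<^sub>F x in in_prob M. K (fst x) < card (Z x \<inter> UNIV)"
    using \<mu>.prob_space by (intro card_gt_K) auto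
  then show ?thesis
    using fin ties
  proof eventually_elim
    case (elim x)
    show ?case
    proof
      fix y assume "y \<in> Z x"
      moreover have "{z\<in>Z x. (y, z) \<in> knn_edges (K (fst x)) (Z x)} = {z. (y, z) \<in> knn_edges (K (fst x)) (Z x)}"
        by (auto simp: knn_edges_def)
      ultimately show "card {z\<in>Z x. (y, z) \<in> knn_edges (K (fst x)) (Z x)} = K (fst x)"
        using knn_outdegree[of "Z x" y "K (fst x)"] elim by simp
    qed
  qed
qed

text \<open>The order of the quantifiers matters: \<open>R\<close> depends on \<open>e\<close>
  alone, so that \<open>r\<close> can later be taken from uniform continuity on a ball determined by
  \<open>R\<close>.\<close>

lemma mostly_short_edges:
  assumes e: "e > 0"
  obtains R where "R > 0" "\<And>r. r > 0 \<Longrightarrow> \<forall>\<^sub>F x in in_prob M.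
    real (card {y\<in>Z x. R < norm y \<or> (\<exists>z. (y, z) \<in> knn_edges (K (fst x)) (Z x) \<and> r \<le> dist y z)}) \<le> e * real (fst x)"
proof -
  have "(\<lambda>n. measure \<mu> (- cball 0 (real n))) \<longlonglongrightarrow> 0"
  proof (rule \<mu>.measure_tendsto_0)
    show "AE x in \<mu>. \<forall>\<^sub>F n in sequentially. x \<notin> - cball 0 (real n)"
    proof (rule AE_I2)
      fix x :: 'a
      show "\<forall>\<^sub>F n in sequentially. x \<notin> - cball 0 (real n)"
        using eventually_ge_at_top[of "nat \<lceil>norm x\<rceil>"] 
      proof eventually_elim
        case (elim n)
        then have "norm x \<le> real n" by linarith
        then show ?case by simp
      qed
    qed
  qed auto
  then have "\<forall>\<^sub>F n in sequentially. measure \<mu> (- cball 0 (real n)) < e / 2"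
    using e by (intro order_tendstoD(2)) auto
  then have "\<forall>\<^sub>F n in sequentially. measure \<mu> (- cball 0 (real n)) < e / 2 \<and> 0 < n"
    using eventually_gt_at_top by (rule eventually_conj)
  then obtain n where n: "measure \<mu> (- cball 0 (real n)) < e / 2" "0 < n"
    using eventually_happens[of _ sequentially] by force
  define R where "R = real n"
  have "\<forall>\<^sub>F x in in_prob M.
    real (card {y\<in>Z x. R < norm y \<or> (\<exists>z. (y, z) \<in> knn_edges (K (fst x)) (Z x) \<and> r \<le> dist y z)}) \<le> e * real (fst x)"
    if r: "r > 0" for r
  proof -
    have "cball (0::'a) R \<subseteq> (\<Union>d\<in>UNIV. ball d (r/2))" using r centre_in_ball[of _ "r/2"] by fastforce
    then obtain D where D: "finite D" "cball (0::'a) R \<subseteq> (\<Union>d\<in>D. ball d (r/2))"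
      by (metis compact_cball compactE_image[of "cball (0::'a) R" UNIV "\<lambda>d. ball d (r/2)"] open_ball)
    \<comment> \<open>Balls of mass 0 need not contain many points, but by the convergence of counts
      they hold only a vanishing fraction of them, so these points may all be counted as
      bad.\<close>
    define D0 where "D0 = {d\<in>D. measure \<mu> (ball d (r/2)) = 0}"
    have D0: "finite D0" using D(1) by (simp add: D0_def)
    have many: "\<forall>\<^sub>F x in in_prob M. \<forall>d\<in>D - D0. K (fst x) < card (Z x \<inter> ball d (r/2))"
      using D(1) by (intro eventually_ball_finite ballI card_gt_K)
        (auto simp: D0_def less_le)
    have lim: "((\<lambda>x. real (card (Z x \<inter> - cball 0 R)) / real (fst x) +
        (\<Sum>d\<in>D0. real (card (Z x \<inter> ball d (r/2))) / real (fst x))) \<longlongrightarrow>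
        measure \<mu> (- cball 0 R) + (\<Sum>d\<in>D0. measure \<mu> (ball d (r/2)))) (in_prob M)"
      by (intro tendsto_add tendsto_sum cnt) auto
    have "(\<Sum>d\<in>D0. measure \<mu> (ball d (r/2))) = 0" by (simp add: D0_def)
    then have "measure \<mu> (- cball 0 R) + (\<Sum>d\<in>D0. measure \<mu> (ball d (r/2))) < e"
      using n e by (simp add: R_def)
    from order_tendstoD(2)[OF lim this] many show ?thesis
      using fin N_pos
    proof eventually_elim
      case (elim x)
      let ?B = "{y\<in>Z x. R < norm y \<or> (\<exists>z. (y, z) \<in> knn_edges (K (fst x)) (Z x) \<and> r \<le> dist y z)}"
      have "?B \<subseteq> (Z x \<inter> - cball 0 R) \<union> (\<Union>d\<in>D0. Z x \<inter> ball d (r/2))"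
      proof
        fix y assume y: "y \<in> ?B"
        show "y \<in> (Z x \<inter> - cball 0 R) \<union> (\<Union>d\<in>D0. Z x \<inter> ball d (r/2))"
        proof (cases "R < norm y")
          case False
          then have "y \<in> (\<Union>d\<in>D. ball d (r/2))" using D(2) by (simp add: subset_iff)
          then obtain d where d: "d \<in> D" "y \<in> ball d (r/2)" by blast
          have "d \<in> D0"
          proof (rule ccontr)
            assume "d \<notin> D0"
            then have K: "K (fst x) < card (Z x \<inter> ball d (r/2))" using elim(2) d by blast
            obtain z where z: "(y, z) \<in> knn_edges (K (fst x)) (Z x)" "r \<le> dist y z" using y False by blast
            \<comment> \<open>Points in a common ball of radius \<open>r / 2\<close> are less than
              \<open>r\<close> apart. Even without \<open>y\<close> itself the ball holds at least
              \<open>K\<close> points, all closer to \<open>y\<close> than the far end of a long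
              edge: a contradiction.\<close>
            have "(Z x \<inter> ball d (r/2)) - {y} \<subseteq> {l \<in> Z x - {y}. dist y l < dist y z}"
            proof
              fix l assume l: "l \<in> (Z x \<inter> ball d (r/2)) - {y}"
              have "dist y l \<le> dist d y + dist d l" by (metis dist_commute dist_triangle)
              also have "\<dots> < r" using l d by simp
              finally show "l \<in> {l \<in> Z x - {y}. dist y l < dist y z}" using l z by auto
            qed
            then have "card ((Z x \<inter> ball d (r/2)) - {y}) \<le> card {l \<in> Z x - {y}. dist y l < dist y z}"
              using elim(3) by (intro card_mono) auto
            also have "\<dots> < K (fst x)" using z(1) by (simp add: knn_edges_def)
            finally show False using K elim(3) y d by (simp add: card_Diff_singleton_if split: if_splits)
          qed
          then show ?thesis using y d by blast
        qed (use y in auto)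
      qed
      then have "card ?B \<le> card ((Z x \<inter> - cball 0 R) \<union> (\<Union>d\<in>D0. Z x \<inter> ball d (r/2)))"
        using elim(3) D0 by (intro card_mono) auto
      also have "\<dots> \<le> card (Z x \<inter> - cball 0 R) + (\<Sum>d\<in>D0. card (Z x \<inter> ball d (r/2)))"
        using card_UN_le[OF D0, of "\<lambda>d. Z x \<inter> ball d (r/2)"] by (intro order_trans[OF card_Un_le]) simp
      finally have "real (card ?B) \<le> real (card (Z x \<inter> - cball 0 R)) + (\<Sum>d\<in>D0. real (card (Z x \<inter> ball d (r/2))))"
        by (simp only: of_nat_le_iff flip: of_nat_sum of_nat_add)
      also have "\<dots> \<le> e * real (fst x)"
        using elim(1,4) by (simp add: pos_divide_less_eq less_imp_le flip: sum_divide_distrib add_divide_distrib)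
      finally show ?case .
    qed
  qed
  then show thesis using that[of R] n by (auto simp: R_def)
qed

lemma mean_cross_edges_tendsto:
  fixes a h :: "'a \<Rightarrow> real" and \<pi> :: "nat \<Rightarrow> 'a \<Rightarrow> nat \<Rightarrow> real"
  assumes [measurable]: "a \<in> borel_measurable borel" "h \<in> borel_measurable borel"
    and a: "\<And>y. 0 \<le> a y \<and> a y \<le> 1" and h: "\<And>y. 0 \<le> h y \<and> h y \<le> 1"
    and \<pi>: "\<And>N y j. 0 \<le> \<pi> N y j \<and> \<pi> N y j \<le> 1"
    and lim: "\<And>e. e > 0 \<Longrightarrow> \<forall>\<^sub>F N in sequentially. \<forall>y. \<bar>\<pi> N y 1 - a y\<bar> \<le> e \<and> \<bar>\<pi> N y 2 - h y\<bar> \<le> e"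
  shows "((\<lambda>x. mean_cross_edges (Z x) (\<pi> (fst x)) (knn_edges (K (fst x)) (Z x)) / (real (fst x) * real (K (fst x))))
    \<longlongrightarrow> (\<integral>y. a y * h y \<partial>\<mu>)) (in_prob M)"
proof -
  let ?T = "\<lambda>x. mean_cross_edges (Z x) (\<pi> (fst x)) (knn_edges (K (fst x)) (Z x))"
  obtain C :: nat where C: "\<And>K S (y :: 'a). finite S \<Longrightarrow> card {x. (x, y) \<in> knn_edges K S} \<le> C * K"
    using knn_indegree_bound by blast
  have "((\<lambda>x. ?T x / (real (fst x) * real (K (fst x))) - (\<Sum>y\<in>Z x. a y * h y) / real (fst x)) \<longlongrightarrow> 0) (in_prob M)"
  proof (rule tendstoI)
    fix e0 :: real assume e0: "e0 > 0"
    \<comment> \<open>The errors below add up to at most \<open>e * (8 + (C + 1))\<close>, including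
      six from \<open>3 * e\<close> and the bound \<open>2 N\<close> on the number of points, and
      one from \<open>B\<close>; the denominator leaves room for a strict inequality.\<close>
    define e where "e = e0 / (9 + 2 * (real C + 1))"
    have e: "e > 0" using e0 by (simp add: e_def add_pos_nonneg)
    have e0_eq: "e * (9 + 2 * (real C + 1)) = e0"
      by (simp add: e_def add_nonneg_eq_0_iff)
    obtain v where v_cont: "continuous_on UNIV v" and v: "\<And>y. 0 \<le> v y \<and> v y \<le> 1"
      and hv: "(\<integral>y. \<bar>h y - v y\<bar> \<partial>\<mu>) < e"
      using continuous_L1_approximation[of h \<phi> e] h e \<mu>.finite_measure_axioms by auto
    have [measurable]: "v \<in> borel_measurable borel"
      by (rule borel_measurable_continuous_onI[OF v_cont])
    have hv01: "0 \<le> \<bar>h y - v y\<bar> \<and> \<bar>h y - v y\<bar> \<le> 1" for y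
      using h[of y] v[of y] by linarith
    obtain R where R: "R > 0" and short: "\<And>r. r > 0 \<Longrightarrow> \<forall>\<^sub>F x in in_prob M.
      real (card {y\<in>Z x. R < norm y \<or> (\<exists>z. (y, z) \<in> knn_edges (K (fst x)) (Z x) \<and> r \<le> dist y z)}) \<le> e * real (fst x)"
      using mostly_short_edges[OF e] by blast
    \<comment> \<open>The margin 1, together with \<open>r \<le> 1\<close>, keeps both ends of a
      short edge starting in the ball of radius \<open>R\<close> inside this compact set.\<close>
    have "uniformly_continuous_on (cball 0 (R + 1)) v"
      by (intro compact_uniformly_continuous continuous_on_subset[OF v_cont]) auto
    then obtain r0 where r0: "r0 > 0"
      "\<And>y z. y \<in> cball 0 (R + 1) \<Longrightarrow> z \<in> cball 0 (R + 1) \<Longrightarrow> dist z y < r0 \<Longrightarrow> dist (v z) (v y) < e"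
      unfolding uniformly_continuous_on_def using e by blast
    define r where "r = min r0 1"
    have r: "r > 0" using r0 by (simp add: r_def)
    have "\<forall>\<^sub>F x in in_prob M. (\<Sum>y\<in>Z x. \<bar>h y - v y\<bar>) / real (fst x) < e"
      by (rule order_tendstoD(2)[OF law_of_large_numbers[OF _ hv01] hv]) measurable
    then have "\<forall>\<^sub>F x in in_prob M. ?T x / (real (fst x) * real (K (fst x))) - (\<Sum>y\<in>Z x. a y * h y) / real (fst x)
        \<in> {- (e * (8 + (real C + 1)))..e * (8 + (real C + 1))}"
      using short[OF r] outdegree fin N_pos card_Z_le
        eventually_fst_in_prob[OF lim[OF e], of M] eventually_fst_in_prob[OF K_pos, of M]
    proof eventually_elim
      case (elim x)
      let ?N = "real (fst x)" and ?K = "K (fst x)"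
      let ?E = "knn_edges ?K (Z x)"
      define B where "B = {y\<in>Z x. R < norm y \<or> (\<exists>z. (y, z) \<in> ?E \<and> r \<le> dist y z)}"
      have NK: "0 < ?N" "0 < real ?K" using elim by auto
      have "\<bar>?T x - real ?K * (\<Sum>y\<in>Z x. a y * h y)\<bar>
        \<le> real ?K * (3 * e * real (card (Z x)) + (real C + 1) * (\<Sum>y\<in>Z x. \<bar>h y - v y\<bar>) + real (card B))"
        unfolding mean_cross_edges_def
      proof (rule edge_sum_approx)
        show "card {z \<in> Z x. (y, z) \<in> ?E} = ?K" if "y \<in> Z x" for y using elim(3) that by blast
        show "card {y \<in> Z x. (y, z) \<in> ?E} \<le> C * ?K" for z
        proof -
          have "{y \<in> Z x. (y, z) \<in> ?E} = {y. (y, z) \<in> ?E}" by (auto simp: knn_edges_def)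
          then show ?thesis using C[OF elim(4)] by simp
        qed
        show "\<bar>v z - v y\<bar> \<le> e" if "y \<in> Z x - B" "z \<in> Z x" "(y, z) \<in> ?E" for y z
        proof -
          have *: "norm y \<le> R" "dist y z < r" using that by (auto simp: B_def not_less not_le)
          then have "norm z \<le> R + 1"
            using norm_triangle_ineq2[of z y] by (simp add: r_def dist_norm norm_minus_commute)
          then show ?thesis
            using r0(2)[of y z] * by (simp add: r_def dist_real_def dist_commute)
        qed
      qed (use elim a h v \<pi> e in \<open>auto simp: B_def\<close>)
      also have "\<dots> \<le> real ?K * (3 * e * (2 * ?N) + (real C + 1) * (e * ?N) + e * ?N)"
        using elim(1,2,6) e NK(1) unfolding B_def
        by (intro mult_left_mono add_mono) (auto simp: field_simps)
      also have "\<dots> \<le> (?N * real ?K) * (e * (8 + (real C + 1)))"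
        using e NK by (simp add: algebra_simps)
      finally have "\<bar>?T x - real ?K * (\<Sum>y\<in>Z x. a y * h y)\<bar> / (?N * real ?K) \<le> e * (8 + (real C + 1))"
        using NK by (simp add: divide_le_eq mult.commute)
      moreover have "?T x / (?N * real ?K) - (\<Sum>y\<in>Z x. a y * h y) / ?N =
        (?T x - real ?K * (\<Sum>y\<in>Z x. a y * h y)) / (?N * real ?K)"
        using NK by (simp add: field_simps)
      moreover have "\<bar>?T x - real ?K * (\<Sum>y\<in>Z x. a y * h y)\<bar> / (?N * real ?K) =
        \<bar>(?T x - real ?K * (\<Sum>y\<in>Z x. a y * h y)) / (?N * real ?K)\<bar>"
        using NK by (simp only: abs_divide) simp
      ultimately have "\<bar>?T x / (?N * real ?K) - (\<Sum>y\<in>Z x. a y * h y) / ?N\<bar> \<le> e * (8 + (real C + 1))"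
        by metis
      from abs_le_D1[OF this] abs_le_D2[OF this] show ?case
        by (simp only: atLeastAtMost_iff minus_le_iff)
    qed
    then show "\<forall>\<^sub>F x in in_prob M. dist (?T x / (real (fst x) * real (K (fst x))) - (\<Sum>y\<in>Z x. a y * h y) / real (fst x)) 0 < e0"
    proof eventually_elim
      case (elim x)
      have "e * (8 + (real C + 1)) < e0"
        unfolding e0_eq[symmetric] using e by (intro mult_strict_left_mono) auto
      then show ?case using elim by (auto simp: dist_real_def abs_less_iff)
    qed
  qed
  moreover have "((\<lambda>x. (\<Sum>y\<in>Z x. a y * h y) / real (fst x)) \<longlongrightarrow> (\<integral>y. a y * h y \<partial>\<mu>)) (in_prob M)"
    using a h by (intro law_of_large_numbers) (auto intro: mult_le_one)
  ultimately show ?thesis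
    using tendsto_add by fastforce
qed

end

subsection \<open>The two-sample problem\<close>

text \<open>The difference equals \<open>(P - p) * f * g\<close> over the product of the
  denominators. Bounding one of them below by \<open>P * f\<close> and the other by
  \<open>(1 - p) * g\<close> cancels \<open>f * g\<close>, so the estimate is uniform in the point
  although the densities may be unbounded or vanish.\<close>

lemma weight_ratio_close:
  fixes P Q p f g :: real
  assumes "0 \<le> f" "0 \<le> g" "0 < P" "0 < Q" "P + Q = 1" "0 < p" "p < 1"
  shows "\<bar>P * f / (P * f + Q * g) - p * f / (p * f + (1 - p) * g)\<bar> \<le> \<bar>P - p\<bar> / (P * (1 - p))"
proof (cases "f = 0 \<or> g = 0")
  case True
  then show ?thesis using assms by auto
next
  case False
  then have f: "0 < f" and g: "0 < g" using assms by auto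
  have d1: "0 < P * f + Q * g" and d2: "0 < p * f + (1 - p) * g"
    using f g assms by (auto intro!: add_pos_pos)
  have Q: "Q = 1 - P" using assms by simp
  have "P * f / (P * f + Q * g) - p * f / (p * f + (1 - p) * g) =
     ((P - p) * (f * g)) / ((P * f + Q * g) * (p * f + (1 - p) * g))"
    using d1 d2 by (simp add: diff_frac_eq Q) (simp add: algebra_simps)
  also have "\<bar>\<dots>\<bar> = \<bar>P - p\<bar> * (f * g) / ((P * f + Q * g) * (p * f + (1 - p) * g))"
    using d1 d2 f g by (simp add: abs_mult)
  also have "\<dots> \<le> \<bar>P - p\<bar> * (f * g) / ((P * f) * ((1 - p) * g))"
    using f g assms by (intro divide_left_mono mult_mono mult_pos_pos) (auto intro!: add_pos_pos)
  also have "\<dots> = \<bar>P - p\<bar> / (P * (1 - p))"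
    using f g by simp
  finally show ?thesis .
qed

lemma label_prob_sum:
  assumes "n1 * f z + n2 * g z \<noteq> 0"
  shows "label_prob n1 n2 f g z 1 + label_prob n1 n2 f g z 2 = 1"
  using assms by (simp add: label_prob_def add_divide_distrib[symmetric])

lemma label_prob_bounds:
  assumes "0 \<le> n1" "0 \<le> n2" "\<And>z. 0 \<le> f z" "\<And>z. 0 \<le> g z"
  shows "0 \<le> label_prob n1 n2 f g z j" "label_prob n1 n2 f g z j \<le> 1"
proof -
  have "0 \<le> n1 * f z" "0 \<le> n2 * g z" using assms by simp_all
  then show "0 \<le> label_prob n1 n2 f g z j" "label_prob n1 n2 f g z j \<le> 1"
    by (auto simp: label_prob_def divide_le_eq_1 intro: divide_nonneg_nonneg)
qed

lemma label_prob_scale: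
  assumes "N \<noteq> 0"
  shows "label_prob n1 n2 f g z j = label_prob (n1 / N) (n2 / N) f g z j"
proof -
  have "n1 / N * f z + n2 / N * g z = (n1 * f z + n2 * g z) / N" by (simp add: add_divide_distrib)
  then show ?thesis using assms by (simp add: label_prob_def)
qed

text \<open>Label 2 has the complementary probability of label 1, so its error is the same; where
  \<open>f = g = 0\<close> all four probabilities are 0.\<close>

lemma label_prob_close:
  assumes "0 \<le> f z" "0 \<le> g z" "0 < P" "0 < Q" "P + Q = 1" "0 < p" "p < 1" "j = 1 \<or> j = 2"
  shows "\<bar>label_prob P Q f g z j - label_prob p (1 - p) f g z j\<bar> \<le> \<bar>P - p\<bar> / (P * (1 - p))"
proof -
  have 1: "\<bar>label_prob P Q f g z 1 - label_prob p (1 - p) f g z 1\<bar> \<le> \<bar>P - p\<bar> / (P * (1 - p))"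
    using weight_ratio_close[of "f z" "g z" P Q p] assms by (simp add: label_prob_def)
  show ?thesis
  proof (cases "f z = 0 \<and> g z = 0")
    case True
    then show ?thesis using assms by (simp add: label_prob_def)
  next
    case False
    have pos: "0 < s * f z + t * g z" if "0 < s" "0 < t" for s t
    proof (cases "f z = 0")
      case True
      then show ?thesis using False assms that by simp
    next
      case False
      then have "0 < s * f z" using assms that by simp
      then show ?thesis using assms that by (intro add_pos_nonneg) auto
    qed
    have "0 < P * f z + Q * g z" "0 < p * f z + (1 - p) * g z"
      using assms by (auto intro!: pos)
    then have "label_prob P Q f g z 1 + label_prob P Q f g z 2 = 1"
      "label_prob p (1 - p) f g z 1 + label_prob p (1 - p) f g z 2 = 1"
      by (intro label_prob_sum; simp)+
    then show ?thesis using 1 assms(8) by auto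
  qed
qed

lemma prob_density_integrable:
  assumes "prob_density f"
  shows "integrable lborel f" "(\<integral>x. f x \<partial>lborel) = 1" "0 \<le> f x" "f \<in> borel_measurable borel"
proof -
  have f: "f \<in> borel_measurable borel" "\<And>x. 0 \<le> f x" "(\<integral>\<^sup>+x. ennreal (f x) \<partial>lborel) = 1"
    using assms by (auto simp: prob_density_def)
  show int: "integrable lborel f"
    using f by (intro integrableI_nonneg) auto
  show "(\<integral>x. f x \<partial>lborel) = 1"
    using f by (subst integral_eq_nn_integral) auto
  show "0 \<le> f x" "f \<in> borel_measurable borel" by fact+
qed

text \<open>With degrees at most \<open>(1 + C) * k\<close> and at most \<open>2 N\<close> points,
  the failure probability is at most \<open>2 N (1 + C)\<^sup>2 k\<^sup>2 / (e N k)\<^sup>2\<close>;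
  \<open>k\<close> cancels and \<open>2 (1 + C)\<^sup>2 / (e\<^sup>2 N)\<close> tends to 0.\<close>

lemma cross_edge_count_concentration:
  fixes Z :: "nat \<Rightarrow> 'w \<Rightarrow> 'a::euclidean_space set"
  assumes pp: "\<forall>\<^sub>F N in sequentially. poisson_process (M N) (Z N) (u N)"
    and lab: "\<forall>\<^sub>F N in sequentially. indep_labels (M N) (Z N) (c N) (\<pi> N)"
    and \<pi>_meas: "\<And>N j. (\<lambda>z. \<pi> N z j) \<in> borel_measurable borel"
    and \<pi>_01: "\<And>N z j. 0 \<le> \<pi> N z j \<and> \<pi> N z j \<le> 1"
    and \<pi>_sum: "\<forall>\<^sub>F N in sequentially. \<forall>z. u N z \<noteq> 0 \<longrightarrow> \<pi> N z 1 + \<pi> N z 2 = 1"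
    and card: "\<forall>\<^sub>F x in in_prob M. real (card (Z (fst x) (snd x))) \<le> 2 * real (fst x)"
    and K_pos: "\<forall>\<^sub>F N in sequentially. 1 \<le> K N"
  defines "T \<equiv> \<lambda>N \<omega>. cross_edge_count (Z N \<omega>) (c N \<omega>) (knn_edges (K N) (Z N \<omega>))"
  shows "\<forall>\<^sub>F N in sequentially. T N \<in> borel_measurable (M N)"
    and "((\<lambda>(N, \<omega>). (T N \<omega> - mean_cross_edges (Z N \<omega>) (\<pi> N) (knn_edges (K N) (Z N \<omega>))) / (real N * real (K N)))
      \<longlongrightarrow> 0) (in_prob M)"
proof -
  let ?Tm = "\<lambda>N \<omega>. mean_cross_edges (Z N \<omega>) (\<pi> N) (knn_edges (K N) (Z N \<omega>))"
  obtain C :: nat where C: "\<And>K S (y :: 'a). finite S \<Longrightarrow> card {x. (x, y) \<in> knn_edges K S} \<le> C * K"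
    using knn_indegree_bound by blast
  have main: "\<forall>\<^sub>F N in sequentially. T N \<in> borel_measurable (M N) \<and> ?Tm N \<in> borel_measurable (M N) \<and>
    (\<forall>t>0. measure (M N) {\<omega>\<in>space (M N). card (Z N \<omega>) \<le> 2 * N \<and> t \<le> \<bar>T N \<omega> - ?Tm N \<omega>\<bar>}
        \<le> real (2 * N) * (real (K N + C * K N))\<^sup>2 / t\<^sup>2)"
    using pp lab \<pi>_sum
  proof eventually_elim
    case (elim N)
    from elim(2) obtain X where X: "\<And>i. X i \<in> points_algebra (M N) (Z N) \<rightarrow>\<^sub>M borel"
      "\<And>\<omega>. \<omega> \<in> space (M N) \<Longrightarrow> bij_betw (\<lambda>i. X i \<omega>) {..<card (Z N \<omega>)} (Z N \<omega>)"
      "\<And>i j. {\<omega>\<in>space (M N). i < card (Z N \<omega>) \<and> c N \<omega> (X i \<omega>) = j} \<in> sets (M N)"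
      "\<And>a :: nat \<Rightarrow> nat. AE \<omega> in M N.
           real_cond_exp (M N) (points_algebra (M N) (Z N))
             (indicat_real {\<omega>\<in>space (M N). \<forall>i<card (Z N \<omega>). c N \<omega> (X i \<omega>) = a i}) \<omega> =
           (\<Prod>i<card (Z N \<omega>). \<pi> N (X i \<omega>) (a i))"
      unfolding indep_labels_def by blast
    have u_meas [measurable]: "u N \<in> borel_measurable borel"
      using borel_measurable_integrable[OF poisson_process_integrable[OF elim(1)]] by simp
    \<comment> \<open>Almost surely no point falls where the intensity vanishes, the only place
      where the label probabilities may fail to sum to 1.\<close>
    have "{x\<in>space borel. u N x = 0} \<in> sets borel" by measurable
    then have u0: "{x. u N x = 0} \<in> sets borel" by simp
    have "(LINT x:{x. u N x = 0}|lborel. u N x) = 0"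
      unfolding set_lebesgue_integral_def by (rule integral_eq_zero_AE) (auto simp: indicator_def)
    then have "AE \<omega> in M N. Z N \<omega> \<inter> {x. u N x = 0} = {}"
      by (rule poisson_process_null_set[OF elim(1) u0])
    then have sum: "AE \<omega> in M N. \<forall>z\<in>Z N \<omega>. \<pi> N z 1 + \<pi> N z 2 = 1"
      by eventually_elim (use elim(3) in blast)
    interpret L: labelled_process "M N" "Z N" "u N" "c N" "\<pi> N" X "K N"
      by (unfold_locales; (fact | use \<pi>_01 in blast)?)
    have "AE \<omega> in M N. \<forall>x\<in>Z N \<omega>.
      card {y. (x, y) \<in> knn_edges (K N) (Z N \<omega>)} + card {y. (y, x) \<in> knn_edges (K N) (Z N \<omega>)} \<le> K N + C * K N"
      using poisson_process_tie_free[OF elim(1)] AE_space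
    proof eventually_elim
      case (elim \<omega>)
      have "finite (Z N \<omega>)" by (rule poisson_process_finite[OF L.pp elim(2)])
      then show ?case
        using C[of "Z N \<omega>"] elim(1) by (intro ballI add_mono) (auto simp: knn_outdegree)
    qed
    from L.label_concentration[OF this]
    show ?case
      using L.T_M L.T_mean_M unfolding T_def L.T_def[abs_def] L.T_mean_def[abs_def] by blast
  qed
  show "\<forall>\<^sub>F N in sequentially. T N \<in> borel_measurable (M N)"
    using main by eventually_elim blast
  show "((\<lambda>(N, \<omega>). (T N \<omega> - ?Tm N \<omega>) / (real N * real (K N))) \<longlongrightarrow> 0) (in_prob M)"
  proof (rule tendstoI)
    fix e :: real assume e: "e > 0"
    let ?t = "\<lambda>N. e * (real N * real (K N))"
    \<comment> \<open>The cap on the number of points is part of the bad event, since the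
      concentration bound needs it; outside \<open>?B\<close> it becomes a premise, discharged by
      \<open>card\<close>.\<close>
    let ?B = "\<lambda>N. {\<omega>\<in>space (M N). card (Z N \<omega>) \<le> 2 * N \<and> ?t N \<le> \<bar>T N \<omega> - ?Tm N \<omega>\<bar>}"
    let ?r = "\<lambda>N. 2 * (1 + real C)\<^sup>2 / e\<^sup>2 * (1 / real N)"
    have r: "?r \<longlonglongrightarrow> 0"
      by (rule tendsto_mult_right_zero) (rule lim_1_over_n)
    have "\<forall>\<^sub>F N in sequentially. ?B N \<in> sets (M N) \<and> measure (M N) (?B N) \<le> ?r N \<and>
      (\<forall>\<omega>\<in>space (M N) - ?B N. card (Z (fst (N, \<omega>)) (snd (N, \<omega>))) \<le> 2 * fst (N, \<omega>) \<longrightarrow>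
          \<bar>T (fst (N, \<omega>)) (snd (N, \<omega>)) - ?Tm (fst (N, \<omega>)) (snd (N, \<omega>))\<bar> < ?t (fst (N, \<omega>)))"
      using main pp K_pos eventually_gt_at_top[of 0]
    proof eventually_elim
      case (elim N)
      have [measurable]: "T N \<in> borel_measurable (M N)" "?Tm N \<in> borel_measurable (M N)"
        "(\<lambda>\<omega>. card (Z N \<omega>)) \<in> M N \<rightarrow>\<^sub>M count_space UNIV"
        using elim poisson_process_card_measurable by blast+
      have t: "0 < ?t N" using elim e by simp
      have "measure (M N) (?B N) \<le> real (2 * N) * (real (K N + C * K N))\<^sup>2 / (?t N)\<^sup>2"
        using elim(1) t by blast
      also have "\<dots> = ?r N"
        using elim(3,4) e by (simp add: power2_eq_square field_simps)
      finally show ?case by (auto simp: not_le)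
    qed
    then have "\<forall>\<^sub>F x in in_prob M. card (Z (fst x) (snd x)) \<le> 2 * fst x \<longrightarrow>
        \<bar>T (fst x) (snd x) - ?Tm (fst x) (snd x)\<bar> < ?t (fst x)"
      by (rule eventually_in_probI[OF _ r])
    then show "\<forall>\<^sub>F x in in_prob M. dist (case x of (N, \<omega>) \<Rightarrow> (T N \<omega> - ?Tm N \<omega>) / (real N * real (K N))) 0 < e"
      using card eventually_fst_in_prob[OF K_pos, of M] eventually_fst_in_prob[OF eventually_gt_at_top[of 0], of M]
    proof eventually_elim
      case (elim x)
      have "real (card (Z (fst x) (snd x))) \<le> real (2 * fst x)" using elim(2) by simp
      then have "\<bar>T (fst x) (snd x) - ?Tm (fst x) (snd x)\<bar> < ?t (fst x)"
        using elim(1) by (simp only: of_nat_le_iff)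
      then show ?case
        using elim(3,4) by (simp add: case_prod_unfold dist_real_def abs_divide pos_divide_less_eq abs_mult)
    qed
  qed
qed

theorem proposition2p1:
  fixes f g :: "real ^ 'd \<Rightarrow> real" and p :: real
    and N\<^sub>1 N\<^sub>2 k :: "nat \<Rightarrow> nat"
    and M :: "nat \<Rightarrow> 'w measure"
    and Z :: "nat \<Rightarrow> 'w \<Rightarrow> (real ^ 'd) set"
    and c :: "nat \<Rightarrow> 'w \<Rightarrow> real ^ 'd \<Rightarrow> nat"
  assumes p: "0 < p" "p < 1"
    and f: "prob_density f" and g: "prob_density g"
    and N_sum: "\<And>N. N \<ge> 1 \<Longrightarrow> N\<^sub>1 N + N\<^sub>2 N = N"
    and N1: "(\<lambda>N. real (N\<^sub>1 N) / real N - p) \<in> o(\<lambda>N. real N powr (- 1 / 2))"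
    and N2: "(\<lambda>N. real (N\<^sub>2 N) / real N - (1 - p)) \<in> o(\<lambda>N. real N powr (- 1 / 2))"
    and Z: "\<And>N. N \<ge> 1 \<Longrightarrow>
      poisson_process (M N) (Z N) (\<lambda>x. real (N\<^sub>1 N) * f x + real (N\<^sub>2 N) * g x)"
    and c: "\<And>N. N \<ge> 1 \<Longrightarrow>
      indep_labels (M N) (Z N) (c N) (label_prob (real (N\<^sub>1 N)) (real (N\<^sub>2 N)) f g)"
    and k_pos: "\<And>N. N \<ge> 1 \<Longrightarrow> k N \<ge> 1"
    and k: "(\<lambda>N. real (k N)) \<in> o(\<lambda>N. real N)"
  shows "tendsto_in_probability M
    (\<lambda>N \<omega>. 1 / (real N * real (k N)) *
       cross_edge_count (Z N \<omega>) (c N \<omega>) (knn_edges (k N) (Z N \<omega>)))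
    (henze_penrose f g p)"
proof -
  note f' = prob_density_integrable[OF f] and g' = prob_density_integrable[OF g]
  note [measurable] = f'(4) g'(4)
  note nonneg = f'(3) g'(3)
  define u where "u N x = real (N\<^sub>1 N) * f x + real (N\<^sub>2 N) * g x" for N x
  define \<pi> where "\<pi> N = label_prob (real (N\<^sub>1 N)) (real (N\<^sub>2 N)) f g" for N
  define \<phi> where "\<phi> x = p * f x + (1 - p) * g x" for x
  define a where "a x = label_prob p (1 - p) f g x 1" for x
  define h where "h x = label_prob p (1 - p) f g x 2" for x
  have [measurable]: "\<phi> \<in> borel_measurable borel" by (simp add: \<phi>_def[abs_def])
  have \<phi>_nonneg: "0 \<le> \<phi> x" for x using p nonneg by (simp add: \<phi>_def)
  have \<phi>_int: "integrable lborel \<phi>" "(\<integral>x. \<phi> x \<partial>lborel) = 1"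
    using f'(1,2) g'(1,2) by (simp_all add: \<phi>_def[abs_def])
  have [measurable]: "a \<in> borel_measurable borel" "h \<in> borel_measurable borel"
    by (simp_all add: a_def[abs_def] h_def[abs_def] label_prob_def)
  have ev1: "\<forall>\<^sub>F N in sequentially. 1 \<le> N" by (rule eventually_ge_at_top)
  have pp: "\<forall>\<^sub>F N in sequentially. poisson_process (M N) (Z N) (u N)"
    using ev1 by eventually_elim (use Z in \<open>simp add: u_def[abs_def]\<close>)
  have lab: "\<forall>\<^sub>F N in sequentially. indep_labels (M N) (Z N) (c N) (\<pi> N)"
    using ev1 by eventually_elim (use c in \<open>simp add: \<pi>_def\<close>)
  have K_pos: "\<forall>\<^sub>F N in sequentially. 1 \<le> k N"
    using ev1 by eventually_elim (rule k_pos)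
  have K_small: "(\<lambda>N. real (k N) / real N) \<longlonglongrightarrow> 0"
    by (rule smalloD_tendsto[OF k])
  have P_lim: "(\<lambda>N. real (N\<^sub>1 N) / real N) \<longlonglongrightarrow> p"
  proof -
    have "((\<lambda>N. real N powr (- 1 / 2)) \<longlongrightarrow> 0) sequentially"
      by (rule tendsto_neg_powr) (auto simp: filterlim_real_sequentially)
    moreover have "\<forall>\<^sub>F N in sequentially. norm (real (N\<^sub>1 N) / real N - p) \<le> 1 * norm (real N powr (- 1 / 2))"
      by (rule landau_o.smallD[OF N1]) simp
    then have "\<forall>\<^sub>F N in sequentially. norm (real (N\<^sub>1 N) / real N - p) \<le> real N powr (- 1 / 2)"
      by simp
    ultimately have "(\<lambda>N. real (N\<^sub>1 N) / real N - p) \<longlonglongrightarrow> 0"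
      by (rule Lim_null_comparison[rotated])
    then show ?thesis by (rule LIM_zero_cancel)
  qed
  have PQ: "real (N\<^sub>1 N) / real N + real (N\<^sub>2 N) / real N = 1" if "1 \<le> N" for N
  proof -
    have "real (N\<^sub>1 N) + real (N\<^sub>2 N) = real N" using N_sum[OF that] by (metis of_nat_add)
    then show ?thesis using that by (simp add: add_divide_distrib[symmetric])
  qed
  have Q_lim: "(\<lambda>N. real (N\<^sub>2 N) / real N) \<longlonglongrightarrow> 1 - p"
  proof (rule Lim_transform_eventually)
    show "(\<lambda>N. 1 - real (N\<^sub>1 N) / real N) \<longlonglongrightarrow> 1 - p" by (intro tendsto_intros P_lim)
    show "\<forall>\<^sub>F N in sequentially. 1 - real (N\<^sub>1 N) / real N = real (N\<^sub>2 N) / real N"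
      using ev1 by eventually_elim (use PQ in \<open>simp add: algebra_simps\<close>)
  qed

  \<comment> \<open>The limiting measure has density \<open>\<phi>\<close>, whereas the process for
    \<open>N\<close> has intensity \<open>u N\<close>; convergence of \<open>N\<^sub>1 N / N\<close>
    and \<open>N\<^sub>2 N / N\<close> makes the mean counts per \<open>N\<close> converge.\<close>
  interpret knn_asymptotics M "\<lambda>x. Z (fst x) (snd x)" \<phi> k
  proof (rule knn_asymptotics.intro)
    show "\<phi> \<in> borel_measurable borel" by measurable
    show "prob_space (density lborel \<phi>)"
      using \<phi>_nonneg \<phi>_int
      by (intro prob_spaceI) (simp add: emeasure_density nn_integral_eq_integral)
    show "\<forall>\<^sub>F x in in_prob M. finite (Z (fst x) (snd x))"
      using eventually_space_in_prob eventually_fst_in_prob[OF pp]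
      by eventually_elim (rule poisson_process_finite)
    show "\<forall>\<^sub>F x in in_prob M. tie_free (Z (fst x) (snd x))"
    proof (rule eventually_in_prob_AE)
      show "\<forall>\<^sub>F N in sequentially. AE \<omega> in M N. tie_free (Z (fst (N, \<omega>)) (snd (N, \<omega>)))"
        using pp by eventually_elim (simp add: poisson_process_tie_free)
    qed
    show "\<forall>\<^sub>F N in sequentially. 1 \<le> k N" "(\<lambda>N. real (k N) / real N) \<longlonglongrightarrow> 0" by fact+
    fix A :: "(real ^ 'd) set" assume A [measurable]: "A \<in> sets borel"
    have int: "integrable lborel (\<lambda>x. indicator A x * f x)" "integrable lborel (\<lambda>x. indicator A x * g x)"
      using integrable_mult_indicator[of A lborel f] integrable_mult_indicator[of A lborel g] f'(1) g'(1) by simp_all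
    have lin: "(LINT x:A|lborel. b * f x + d * g x) = b * (LINT x:A|lborel. f x) + d * (LINT x:A|lborel. g x)" for b d
      using int by (simp add: set_lebesgue_integral_def distrib_left mult.left_commute[of _ b] mult.left_commute[of _ d])
    have "measure (density lborel \<phi>) A = (LINT x:A|lborel. \<phi> x)"
      by (rule measure_density_lborel[OF \<phi>_int(1) \<phi>_nonneg A])
    then have \<mu>A: "measure (density lborel \<phi>) A = p * (LINT x:A|lborel. f x) + (1 - p) * (LINT x:A|lborel. g x)"
      unfolding \<phi>_def lin .
    have "(\<lambda>N. real (N\<^sub>1 N) / real N * (LINT x:A|lborel. f x) + real (N\<^sub>2 N) / real N * (LINT x:A|lborel. g x))
      \<longlonglongrightarrow> measure (density lborel \<phi>) A"
      unfolding \<mu>A by (intro tendsto_intros P_lim Q_lim)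
    then have "(\<lambda>N. (LINT x:A|lborel. u N x) / real N) \<longlonglongrightarrow> measure (density lborel \<phi>) A"
      unfolding u_def lin by (simp add: add_divide_distrib)
    from poisson_count_tendsto[OF pp A this]
    show "((\<lambda>x. real (card (Z (fst x) (snd x) \<inter> A)) / real (fst x)) \<longlongrightarrow> measure (density lborel \<phi>) A) (in_prob M)"
      by (simp add: case_prod_unfold)
  qed

  have \<pi>_01: "0 \<le> \<pi> N z j \<and> \<pi> N z j \<le> 1" for N z j
    unfolding \<pi>_def using label_prob_bounds[of "real (N\<^sub>1 N)" "real (N\<^sub>2 N)" f g] nonneg by simp
  have ah: "0 \<le> a z \<and> a z \<le> 1" "0 \<le> h z \<and> h z \<le> 1" for z
    unfolding a_def h_def using label_prob_bounds[of p "1 - p" f g] p nonneg by simp_all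
  have close: "\<forall>\<^sub>F N in sequentially. \<forall>z. \<bar>\<pi> N z 1 - a z\<bar> \<le> e \<and> \<bar>\<pi> N z 2 - h z\<bar> \<le> e"
    if e: "e > 0" for e
  proof -
    have "(\<lambda>N. \<bar>real (N\<^sub>1 N) / real N - p\<bar> / (real (N\<^sub>1 N) / real N * (1 - p))) \<longlonglongrightarrow> \<bar>p - p\<bar> / (p * (1 - p))"
      using p by (intro tendsto_intros P_lim) auto
    then have "\<forall>\<^sub>F N in sequentially. \<bar>real (N\<^sub>1 N) / real N - p\<bar> / (real (N\<^sub>1 N) / real N * (1 - p)) < e"
      using e by (intro order_tendstoD(2)) auto
    moreover have "\<forall>\<^sub>F N in sequentially. 0 < real (N\<^sub>1 N) / real N"
      by (rule order_tendstoD(1)[OF P_lim]) (use p in simp)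
    moreover have "\<forall>\<^sub>F N in sequentially. 0 < real (N\<^sub>2 N) / real N"
      by (rule order_tendstoD(1)[OF Q_lim]) (use p in simp)
    ultimately show ?thesis
      using ev1
    proof eventually_elim
      case (elim N)
      have "\<bar>\<pi> N z j - label_prob p (1 - p) f g z j\<bar> \<le> e" if "j = 1 \<or> j = 2" for z j
      proof -
        have "\<pi> N z j = label_prob (real (N\<^sub>1 N) / real N) (real (N\<^sub>2 N) / real N) f g z j"
          unfolding \<pi>_def using elim(4) by (intro label_prob_scale) simp
        then show ?thesis
          using label_prob_close[of f z g "real (N\<^sub>1 N) / real N" "real (N\<^sub>2 N) / real N" p j]
            elim nonneg p that PQ by simp
      qed
      then show ?case by (simp add: a_def h_def)
    qed
  qed
  let ?E = "\<lambda>N \<omega>. knn_edges (k N) (Z N \<omega>)"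
  have mean: "((\<lambda>(N, \<omega>). mean_cross_edges (Z N \<omega>) (\<pi> N) (?E N \<omega>) / (real N * real (k N)))
      \<longlongrightarrow> (\<integral>z. a z * h z \<partial>\<mu>)) (in_prob M)"
    using mean_cross_edges_tendsto[of a h \<pi>] ah \<pi>_01 close by (simp add: case_prod_unfold)
  have lim_eq: "(\<integral>z. a z * h z \<partial>\<mu>) = henze_penrose f g p"
  proof -
    have "(\<integral>z. a z * h z \<partial>\<mu>) = (\<integral>z. \<phi> z * (a z * h z) \<partial>lborel)"
      using \<phi>_nonneg by (subst integral_density) auto
    \<comment> \<open>One factor \<open>\<phi>\<close> cancels against the two denominators. Where
      \<open>\<phi> z = 0\<close> both sides are 0 by the convention on division.\<close>
    also have "\<dots> = (\<integral>z. p * (1 - p) * (f z * g z / (p * f z + (1 - p) * g z)) \<partial>lborel)"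
      by (intro Bochner_Integration.integral_cong refl)
        (simp add: a_def h_def label_prob_def \<phi>_def)
    also have "\<dots> = henze_penrose f g p"
      unfolding henze_penrose_def by (rule integral_mult_right_zero)
    finally show ?thesis .
  qed
  have \<pi>_sum: "\<forall>\<^sub>F N in sequentially. \<forall>z. u N z \<noteq> 0 \<longrightarrow> \<pi> N z 1 + \<pi> N z 2 = 1"
    by (intro always_eventually allI impI) (simp add: \<pi>_def u_def label_prob_sum[simplified])
  have \<pi>_meas: "(\<lambda>z. \<pi> N z j) \<in> borel_measurable borel" for N j
    by (simp add: \<pi>_def label_prob_def)
  note conc = cross_edge_count_concentration[OF pp lab \<pi>_meas \<pi>_01 \<pi>_sum card_Z_le K_pos]
  show ?thesis
  proof (rule tendsto_in_probabilityI)
    show "\<forall>\<^sub>F N in sequentially. finite_measure (M N)"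
      using pp by eventually_elim (rule prob_space.finite_measure[OF poisson_process_prob_space])
    show "\<forall>\<^sub>F N in sequentially. (\<lambda>\<omega>. 1 / (real N * real (k N)) *
       cross_edge_count (Z N \<omega>) (c N \<omega>) (?E N \<omega>)) \<in> borel_measurable (M N)"
      using conc(1) by eventually_elim (rule borel_measurable_times[OF borel_measurable_const])
    show "((\<lambda>(N, \<omega>). 1 / (real N * real (k N)) * cross_edge_count (Z N \<omega>) (c N \<omega>) (?E N \<omega>))
      \<longlongrightarrow> henze_penrose f g p) (in_prob M)"
      \<comment> \<open>The statistic is its deviation from the conditional mean, which is
        negligible, plus the conditional mean, which has the stated limit.\<close>
      using tendsto_add[OF conc(2) mean] unfolding lim_eq
      by (simp add: case_prod_unfold diff_divide_distrib)
  qed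
qed

end
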